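(* Let $q$ be a prime power, let $n$ be a positive integer, and let $f\in \mathbb{F}_q[x]$ be a divisor of $x^n-1$ of degree $k$. Let $n_f$ be the number of normal elements $\alpha\in \mathbb{F}_{q^n}$ (over $\mathbb{F}_q$) such that $L_f(\alpha)$ is primitive. Then $$\frac{n_f}{\theta(q^n-1)\,\Theta(x^n-1)}>q^n-q^{n/2+k}\,W(q^n-1)\,W(x^n-1).$$ In particular, if $q^{n/2-k}\ge W(q^n-1)W(x^n-1)$, then there exist primitive $k$-normal elements in $\mathbb{F}_{q^n}$.
   Context: For $f(x)=\sum_{i=0}^r a_ix^i\in\mathbb{F}_q[x]$, its $q$-associate is $L_f(x)=\sum_{i=0}^r a_ix^{q^i}$. An element $\alpha\in\mathbb{F}_{q^n}$ is normal over $\mathbb{F}_q$ if $\alpha,\alpha^q,\dots,\alpha^{q^{n-1}}$ form a basis of $\mathbb{F}_{q^n}$ over $\mathbb{F}_q$; it is $k$-normal over $\mathbb{F}_q$ if the $\mathbb{F}_q$-span of $\alpha,\alpha^q,\dots,\alpha^{q^{n-1}}$ has dimension $n-k$. An element is primitive if it generates the cyclic group $\mathbb{F}_{q^n}^*$. For a positive integer $t$, $\theta(t)=\varphi(t)/t$ with $\varphi$ Euler's function, and $W(t)$ is the number of squarefree positive divisors of $t$. For a monic $T\in\mathbb{F}_q[x]$, $\Phi_q(T)=|(\mathbb{F}_q[x]/\langle T\rangle)^*|$, $\Theta(T)=\Phi_q(T)/q^{\deg T}$, and $W(T)$ is the number of squarefree monic divisors of $T$ in $\mathbb{F}_q[x]$.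 *)

theory Defs
  imports "HOL-Computational_Algebra.Computational_Algebra" "HOL-Number_Theory.Totient"
begin

text \<open>F_q is a finite field type 'a, F_{q^n} is a finite field type 'b, and
  emb :: 'a => 'b is the embedding of F_q into F_{q^n} (a unital ring homomorphism).\<close>

definition ring_emb :: "('a::field \<Rightarrow> 'b::field) \<Rightarrow> bool" where
  "ring_emb emb \<longleftrightarrow> emb 1 = 1 \<and> (\<forall>x y. emb (x + y) = emb x + emb y)
     \<and> (\<forall>x y. emb (x * y) = emb x * emb y)"

definition lin_comb :: "('a::field \<Rightarrow> 'b::field) \<Rightarrow> (nat \<Rightarrow> 'b) \<Rightarrow> nat \<Rightarrow> (nat \<Rightarrow> 'a) \<Rightarrow> 'b" where
  "lin_comb emb v m c = (\<Sum>i<m. emb (c i) * v i)"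

definition fspan :: "('a::field \<Rightarrow> 'b::field) \<Rightarrow> (nat \<Rightarrow> 'b) \<Rightarrow> nat \<Rightarrow> 'b set" where
  "fspan emb v m = range (lin_comb emb v m)"

definition findep :: "('a::field \<Rightarrow> 'b::field) \<Rightarrow> (nat \<Rightarrow> 'b) \<Rightarrow> nat \<Rightarrow> bool" where
  "findep emb v m \<longleftrightarrow> (\<forall>c. lin_comb emb v m c = 0 \<longrightarrow> (\<forall>i<m. c i = 0))"

definition fdim :: "('a::field \<Rightarrow> 'b::field) \<Rightarrow> 'b set \<Rightarrow> nat" where
  "fdim emb S = (THE d. \<exists>v. findep emb v d \<and> fspan emb v d = S)"

definition conjs :: "nat \<Rightarrow> 'b::field \<Rightarrow> nat \<Rightarrow> 'b" where
  "conjs q \<alpha> = (\<lambda>i. \<alpha> ^ (q ^ i))"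

definition normal_elt :: "('a::field \<Rightarrow> 'b::field) \<Rightarrow> nat \<Rightarrow> nat \<Rightarrow> 'b \<Rightarrow> bool" where
  "normal_elt emb q n \<alpha> \<longleftrightarrow> findep emb (conjs q \<alpha>) n \<and> fspan emb (conjs q \<alpha>) n = UNIV"

definition k_normal :: "('a::field \<Rightarrow> 'b::field) \<Rightarrow> nat \<Rightarrow> nat \<Rightarrow> nat \<Rightarrow> 'b \<Rightarrow> bool" where
  "k_normal emb q n k \<alpha> \<longleftrightarrow> fdim emb (fspan emb (conjs q \<alpha>) n) = n - k"

definition primitive_elt :: "'b::field \<Rightarrow> bool" where
  "primitive_elt \<alpha> \<longleftrightarrow> range (\<lambda>j::nat. \<alpha> ^ j) = UNIV - {0}"

definition q_assoc :: "('a::field \<Rightarrow> 'b::field) \<Rightarrow> nat \<Rightarrow> 'a poly \<Rightarrow> 'b \<Rightarrow> 'b" where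
  "q_assoc emb q f x = (\<Sum>i\<le>degree f. emb (coeff f i) * x ^ (q ^ i))"

definition theta_nat :: "nat \<Rightarrow> real" where
  "theta_nat t = real (totient t) / real t"

definition W_nat :: "nat \<Rightarrow> nat" where
  "W_nat t = card {d. d dvd t \<and> squarefree d}"

text \<open>Phi_q(T) = number of units of F_q[x]/<T>, residues represented by
  polynomials reduced modulo T.\<close>
definition Phi_poly :: "'a::field poly \<Rightarrow> nat" where
  "Phi_poly T = card {g. g mod T = g \<and> (\<exists>h. (g * h) mod T = 1 mod T)}"

definition Theta_poly :: "nat \<Rightarrow> 'a::field poly \<Rightarrow> real" where
  "Theta_poly q T = real (Phi_poly T) / real q ^ degree T"

definition W_poly :: "'a::field poly \<Rightarrow> nat" where
  "W_poly T = card {g. lead_coeff g = 1 \<and> g dvd T \<and> squarefree g}"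

end

(* Defs must be imported last: HOL-Algebra declares its own monom, coeff and order. *)
theory Submission
  imports "HOL-Algebra.Multiplicative_Group" Defs
begin

text \<open>
  Let \<open>N = q\<^sup>n\<close> and let \<open>L\<close> be the \<open>q\<close>-associate of \<open>f\<close>. An element \<open>\<beta> \<noteq> 0\<close> is primitive iff for no
  prime \<open>p\<close> dividing \<open>N - 1\<close> it is a \<open>p\<close>-th power, and \<open>\<alpha>\<close> is normal iff for no monic irreducible
  factor \<open>P\<close> of \<open>T = x\<^sup>n - 1\<close> it is annihilated by \<open>T / P\<close>. The indicator of avoiding one of
  these finitely many obstructions equals \<open>(1 - 1/p) (1 - u\<^sub>p)\<close>, respectively \<open>(1 - q\<^bsup>- deg P\<^esup>) (1 - u\<^sub>P)\<close>,
  where \<open>u\<^sub>p\<close> is the mean of the multiplicative characters of order \<open>p\<close> and \<open>u\<^sub>P\<close> the mean of the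
  nontrivial additive characters that are trivial on the kernel of \<open>T / P\<close>. Multiplying out
  \<open>\<Prod>(1 - u\<^sub>i)\<close> gives the factor \<open>\<theta> \<Theta>\<close>, the main term \<open>N - q\<^sup>k\<close>, and at most
  \<open>W(N - 1) W(T) - 1\<close> further terms, each a mean of sums \<open>\<Sum>\<^sub>\<alpha> \<chi>(L \<alpha>) \<psi>(\<alpha>)\<close> with \<open>(\<chi>, \<psi>)\<close> nontrivial.
  Expanding \<open>\<chi>\<close> into additive characters, whose coefficients are Gauss sums, bounds such a sum by
  \<open>|ker L| sqrt N = q\<^bsup>n/2 + k\<^esup>\<close>; the strict inequality comes from \<open>q\<^sup>k < q\<^bsup>n/2 + k\<^esup>\<close>.
  If \<open>\<alpha>\<close> is normal then \<open>L \<alpha>\<close> is \<open>k\<close>-normal.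
\<close>

section \<open>Additive subgroups of finite fields\<close>

definition add_subgroup :: "'a::ab_group_add set \<Rightarrow> bool" where
  "add_subgroup H \<longleftrightarrow> 0 \<in> H \<and> (\<forall>x\<in>H. \<forall>y\<in>H. x - y \<in> H)"

lemma add_subgroup_zero: "add_subgroup H \<Longrightarrow> 0 \<in> H"
  and add_subgroup_diff: "add_subgroup H \<Longrightarrow> x \<in> H \<Longrightarrow> y \<in> H \<Longrightarrow> x - y \<in> H"
  by (auto simp: add_subgroup_def)

lemma add_subgroup_uminus: "add_subgroup H \<Longrightarrow> x \<in> H \<Longrightarrow> - x \<in> H"
  using add_subgroup_diff[of H 0 x] add_subgroup_zero[of H] by simp

lemma add_subgroup_add: "add_subgroup H \<Longrightarrow> x \<in> H \<Longrightarrow> y \<in> H \<Longrightarrow> x + y \<in> H"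
  using add_subgroup_diff[of H x "- y"] add_subgroup_uminus[of H y] by simp

lemma add_subgroup_of_nat_mult:
  fixes H :: "'a::comm_ring_1 set"
  shows "add_subgroup H \<Longrightarrow> x \<in> H \<Longrightarrow> of_nat m * x \<in> H"
  by (induction m) (auto simp: add_subgroup_zero add_subgroup_add algebra_simps)

lemma prime_CHAR_finite_field: "prime CHAR('a::{field,finite})"
  using finite_imp_CHAR_pos[where ?'a = 'a] prime_CHAR_semidom[where ?'a = 'a] by simp

text \<open>The characteristic is prime, so \<open>m\<close> is invertible modulo it and
  \<open>x\<close> is itself a natural multiple of \<open>of_nat m * x\<close>.\<close>

lemma add_subgroup_of_nat_mult_cancel:
  fixes H :: "'a::{field,finite} set"
  assumes H: "add_subgroup H" and mx: "of_nat m * x \<in> H" and m: "\<not> CHAR('a) dvd m"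
  shows "x \<in> H"
proof -
  have "coprime m CHAR('a)"
    using m prime_CHAR_finite_field[where ?'a = 'a] by (metis prime_imp_coprime coprime_commute)
  then obtain k where "[m * k = 1] (mod CHAR('a))"
    using cong_solve_coprime_nat by auto
  then have "of_nat (m * k) = (1::'a)"
    using of_nat_eq_iff_cong_CHAR[of "m * k" 1, where ?'a = 'a] by simp
  then have "of_nat k * (of_nat m * x) = x"
    by (metis mult.assoc mult.commute mult_1 of_nat_mult)
  then show ?thesis
    using add_subgroup_of_nat_mult[OF H mx, of k] by (simp only:)
qed

lemma of_nat_mod_CHAR: "of_nat (i mod CHAR('a)) = (of_nat i :: 'a::comm_ring_1)"
  by (simp add: of_nat_eq_iff_cong_CHAR cong_def)

text \<open>Two representations of one element with different \<open>i\<close> would put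
  \<open>of_nat d * x\<close> into \<open>H\<close> for some \<open>0 < d < CHAR('a)\<close>, hence
  \<open>x\<close> itself. So adjoining one element multiplies the order by exactly the
  characteristic.\<close>

lemma adjoin_add_subgroup:
  fixes H :: "'a::{field,finite} set"
  assumes H: "add_subgroup H" and x: "x \<notin> H"
  defines "H' \<equiv> (\<lambda>(h, i). h + of_nat i * x) ` (H \<times> {..<CHAR('a)})"
  shows "add_subgroup H'" "card H' = card H * CHAR('a)" "H \<subseteq> H'" "x \<in> H'"
proof -
  let ?p = "CHAR('a)"
  have p: "prime ?p" by (rule prime_CHAR_finite_field)
  have mem: "h + of_nat i * x \<in> H'" if "h \<in> H" for h i
  proof -
    have "h + of_nat i * x = h + of_nat (i mod ?p) * x"
      by (simp add: of_nat_mod_CHAR)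
    then show ?thesis
      unfolding H'_def using that p prime_gt_0_nat by (force intro!: image_eqI[of _ _ "(h, i mod ?p)"])
  qed
  show "H \<subseteq> H'"
    using mem[of _ 0] by auto
  show "x \<in> H'"
    using mem[of 0 1] add_subgroup_zero[OF H] by simp
  show "add_subgroup H'"
    unfolding add_subgroup_def
  proof (intro conjI ballI)
    show "0 \<in> H'"
      using mem[of 0 0] add_subgroup_zero[OF H] by simp
    fix a b assume "a \<in> H'" "b \<in> H'"
    then obtain h i h' j where a: "a = h + of_nat i * x" "h \<in> H" "i < ?p"
      and b: "b = h' + of_nat j * x" "h' \<in> H" "j < ?p"
      unfolding H'_def by auto
    \<comment> \<open>Since \<open>j < ?p\<close>, the natural number \<open>i + (?p - j)\<close>
      represents \<open>i - j\<close> modulo the characteristic without truncation.\<close>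
    have "of_nat (i + (?p - j)) = (of_nat i - of_nat j :: 'a)"
      using b(3) by (simp add: of_nat_diff)
    moreover have "a - b = (h - h') + (of_nat i - of_nat j) * x"
      unfolding a b by (simp add: left_diff_distrib)
    ultimately have "a - b = (h - h') + of_nat (i + (?p - j)) * x"
      by (simp only:)
    then show "a - b \<in> H'"
      by (simp only: mem[OF add_subgroup_diff[OF H a(2) b(2)]])
  qed
  have aux: False if "h \<in> H" "h' \<in> H" "i < j" "j < ?p" "h + of_nat i * x = h' + of_nat j * x" for h h' i j
  proof -
    have "of_nat (j - i) * x = h - h'"
      using that(3,5) by (simp add: of_nat_diff algebra_simps)
    then have "of_nat (j - i) * x \<in> H"
      using add_subgroup_diff[OF H that(1,2)] by simp
    moreover have "\<not> ?p dvd j - i"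
      using that(3,4) by (auto dest: dvd_imp_le)
    ultimately show False
      using add_subgroup_of_nat_mult_cancel[OF H] x by blast
  qed
  have "inj_on (\<lambda>(h, i). h + of_nat i * x) (H \<times> {..<?p})"
  proof (rule inj_onI, clarsimp)
    fix h i h' j assume *: "h \<in> H" "i < ?p" "h' \<in> H" "j < ?p" "h + of_nat i * x = h' + of_nat j * x"
    have "i = j"
      using aux[of h h' i j] aux[of h' h j i] * by (metis linorder_neqE_nat)
    then show "h = h' \<and> i = j"
      using * by simp
  qed
  then show "card H' = card H * ?p"
    unfolding H'_def by (simp add: card_image card_cartesian_product)
qed

text \<open>Among the additive subgroups whose order is a power of the characteristic take a maximal
  one; if an element were missing, adjoining it would contradict maximality.\<close>

lemma card_finite_field_eq_CHAR_power: "\<exists>m. card (UNIV::'a::{field,finite} set) = CHAR('a) ^ m"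
proof -
  let ?F = "{H::'a set. add_subgroup H \<and> (\<exists>m. card H = CHAR('a) ^ m)}"
  have "{0} \<in> ?F"
    by (auto simp: add_subgroup_def intro: exI[of _ 0])
  then obtain H where H: "H \<in> ?F" and max: "\<And>H'. H' \<in> ?F \<Longrightarrow> H \<subseteq> H' \<Longrightarrow> H' = H"
    using finite_has_maximal[of ?F] by (metis (no_types, lifting) empty_iff finite)
  have "H = UNIV"
  proof (rule ccontr)
    assume "H \<noteq> UNIV"
    then obtain x where x: "x \<notin> H" by auto
    obtain m where m: "card H = CHAR('a) ^ m" using H by auto
    define H' where "H' = (\<lambda>(h, i). h + of_nat i * x) ` (H \<times> {..<CHAR('a)})"
    note adj = adjoin_add_subgroup[OF _ x, folded H'_def]
    have "card H' = CHAR('a) ^ Suc m"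
      using adj(2) H m by simp
    then have "H' \<in> ?F"
      using adj(1) H by blast
    then show False
      using max adj(3,4) H x by blast
  qed
  then show ?thesis
    using H by auto
qed

section \<open>Characters of finite fields\<close>

definition unity_root :: "nat \<Rightarrow> nat \<Rightarrow> complex" where
  "unity_root m j = cis (2 * pi * real j / real m)"

lemma norm_unity_root [simp]: "norm (unity_root m j) = 1"
  by (simp add: unity_root_def)

lemma unity_root_0 [simp]: "unity_root m 0 = 1"
  by (simp add: unity_root_def)

lemma unity_root_add: "unity_root m (i + j) = unity_root m i * unity_root m j"
  by (simp add: unity_root_def cis_mult add_divide_distrib distrib_left)

lemma unity_root_mult: "unity_root m (i * j) = unity_root m i ^ j"
  by (induction j) (auto simp: unity_root_add)

lemma unity_root_eq_1_iff:
  assumes "m > 0"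
  shows "unity_root m j = 1 \<longleftrightarrow> m dvd j"
proof
  assume "m dvd j"
  then obtain k where k: "j = m * k" by auto
  have "unity_root m m = 1"
    using assms by (simp add: unity_root_def)
  then show "unity_root m j = 1"
    by (simp add: k unity_root_mult)
next
  assume "unity_root m j = 1"
  then have "cos (2 * pi * real j / real m) = 1"
    by (simp add: unity_root_def complex_eq_iff)
  then obtain k :: int where "2 * pi * real j / real m = of_int k * 2 * pi"
    using cos_one_2pi_int by blast
  then have "real j = of_int k * real m"
    using assms by (simp add: field_simps)
  then have "int j = k * int m"
    by (metis of_int_eq_iff of_int_mult of_int_of_nat_eq)
  then show "m dvd j"
    by (metis dvd_triv_right int_dvd_int_iff)
qed

lemma unity_root_cong:
  assumes "m > 0" "[i = j] (mod m)"
  shows "unity_root m i = unity_root m j"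
proof -
  have "unity_root m i = unity_root m (i mod m)" for i
  proof -
    have "unity_root m i = unity_root m (m * (i div m)) * unity_root m (i mod m)"
      by (metis mult_div_mod_eq unity_root_add)
    then show ?thesis
      using assms(1) unity_root_eq_1_iff by simp
  qed
  then show ?thesis
    using assms(2) by (metis cong_def)
qed

definition add_char :: "('a::ab_group_add \<Rightarrow> complex) \<Rightarrow> bool" where
  "add_char \<psi> \<longleftrightarrow> (\<forall>x y. \<psi> (x + y) = \<psi> x * \<psi> y) \<and> (\<forall>x. norm (\<psi> x) = 1)"

lemma add_char_add: "add_char \<psi> \<Longrightarrow> \<psi> (x + y) = \<psi> x * \<psi> y"
  and add_char_norm: "add_char \<psi> \<Longrightarrow> norm (\<psi> x) = 1"
  by (auto simp: add_char_def)

lemma add_char_0: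
  assumes "add_char \<psi>"
  shows "\<psi> 0 = 1"
proof -
  have "\<psi> 0 \<noteq> 0"
    using add_char_norm[OF assms, of 0] by auto
  then show ?thesis
    using add_char_add[OF assms, of 0 0] by simp
qed

lemma add_char_uminus:
  assumes "add_char \<psi>"
  shows "\<psi> (- x) = cnj (\<psi> x)"
proof -
  have "\<psi> (- x) * \<psi> x = 1"
    using add_char_add[OF assms, of "-x" x] add_char_0[OF assms] by simp
  moreover have "cnj (\<psi> x) * \<psi> x = 1"
    using complex_norm_square[of "\<psi> x"] add_char_norm[OF assms, of x] by (simp add: mult.commute)
  moreover have "\<psi> x \<noteq> 0"
    using add_char_norm[OF assms, of x] by auto
  ultimately show ?thesis
    by (metis mult_right_cancel)
qed

lemma add_char_diff:
  assumes "add_char \<psi>"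
  shows "\<psi> (x - y) = \<psi> x * cnj (\<psi> y)"
  using add_char_add[OF assms, of x "- y"] add_char_uminus[OF assms, of y] by simp

text \<open>A subgroup \<open>H\<close> maximal among those avoiding \<open>1\<close> has the residues \<open>0, \<dots>, p - 1\<close> as a transversal,
  which makes \<open>h + i \<mapsto> exp (2 \<pi> \<i> i / p)\<close> a character.\<close>

lemma exists_nontrivial_add_char: "\<exists>\<psi>::'a::{field,finite} \<Rightarrow> complex. add_char \<psi> \<and> \<psi> 1 \<noteq> 1"
proof -
  let ?p = "CHAR('a)"
  have p: "prime ?p" by (rule prime_CHAR_finite_field)
  let ?F = "{H::'a set. add_subgroup H \<and> 1 \<notin> H}"
  have "{0} \<in> ?F"
    by (auto simp: add_subgroup_def)
  then obtain H where H: "H \<in> ?F" and max: "\<And>H'. H' \<in> ?F \<Longrightarrow> H \<subseteq> H' \<Longrightarrow> H' = H"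
    using finite_has_maximal[of ?F] by (metis (no_types, lifting) empty_iff finite)
  then have sub: "add_subgroup H" and one: "1 \<notin> H" by auto
  have H1: "add_subgroup ((\<lambda>(h, i). h + of_nat i * 1) ` (H \<times> {..<?p}))"
    by (rule adjoin_add_subgroup[OF sub one])
  \<comment> \<open>If \<open>x\<close> is not in \<open>H\<close>, then adjoining it must produce
    \<open>1\<close> by maximality, say \<open>1 = h + of_nat i * x\<close>. Here \<open>i\<close>
    is invertible modulo \<open>?p\<close>, since otherwise \<open>1 = h\<close> would lie in
    \<open>H\<close>; solving for \<open>x\<close> gives the claim.\<close>
  have ex: "\<exists>i. x - of_nat i \<in> H" for x
  proof (cases "x \<in> H")
    case True
    then show ?thesis by (auto intro: exI[of _ 0])
  next
    case False
    define H' where "H' = (\<lambda>(h, i). h + of_nat i * x) ` (H \<times> {..<?p})"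
    note adj = adjoin_add_subgroup[OF sub False, folded H'_def]
    have "1 \<in> H'"
      using max[of H'] adj False by blast
    then obtain h i where hi: "1 = h + of_nat i * x" "h \<in> H" "i < ?p"
      unfolding H'_def by auto
    have "\<not> ?p dvd i"
      using hi one by (auto simp flip: of_nat_eq_0_iff_char_dvd)
    moreover have "of_nat i * x \<in> (\<lambda>(h, i). h + of_nat i * 1) ` (H \<times> {..<?p})"
    proof (rule image_eqI[of _ _ "(- h, 1)"])
      show "of_nat i * x = (case (- h, 1) of (h, i) \<Rightarrow> h + of_nat i * 1)"
        using hi(1) by (simp add: algebra_simps)
      show "(- h, 1) \<in> H \<times> {..<?p}"
        using add_subgroup_uminus[OF sub hi(2)] prime_gt_1_nat[OF p] by simp
    qed
    ultimately have "x \<in> (\<lambda>(h, i). h + of_nat i * 1) ` (H \<times> {..<?p})"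
      using add_subgroup_of_nat_mult_cancel[OF H1] by blast
    then obtain h i where "x = h + of_nat i" "h \<in> H" by auto
    then show ?thesis by (auto intro!: exI[of _ i])
  qed
  \<comment> \<open>The choice is determined only modulo \<open>?p\<close>, a difference that
    \<open>unity_root ?p\<close> does not see.\<close>
  define ind where "ind x = (SOME i. x - of_nat i \<in> H)" for x
  have ind: "x - of_nat (ind x) \<in> H" for x
    unfolding ind_def using ex[of x] by (rule someI_ex)
  have aux: "?p dvd i" if "of_nat i \<in> H" for i
    using add_subgroup_of_nat_mult_cancel[OF sub, of i 1] that one by auto
  have cong: "[i = j] (mod ?p)" if "x - of_nat i \<in> H" "x - of_nat j \<in> H" for x i j
  proof -
    have *: "[j = i] (mod ?p)" if "x - of_nat i \<in> H" "x - of_nat j \<in> H" "i \<le> j" for i j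
    proof -
      have "of_nat (j - i) = (x - of_nat i) - (x - of_nat j)"
        using that(3) by (simp add: of_nat_diff)
      then have "?p dvd j - i"
        using aux[of "j - i"] add_subgroup_diff[OF sub that(1,2)] by (simp only:)
      then show ?thesis
        using that(3) cong_altdef_nat by blast
    qed
    show ?thesis
      using *[OF that] *[OF that(2,1)] cong_sym by (cases "i \<le> j") auto
  qed
  define \<psi> where "\<psi> x = unity_root ?p (ind x)" for x
  have p0: "?p > 0" using p prime_gt_0_nat by blast
  have "\<psi> (x + y) = \<psi> x * \<psi> y" for x y
  proof -
    have "(x + y) - of_nat (ind x + ind y) = (x - of_nat (ind x)) + (y - of_nat (ind y))"
      by simp
    then have "(x + y) - of_nat (ind x + ind y) \<in> H"
      using add_subgroup_add[OF sub ind[of x] ind[of y]] by (simp only:)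
    then have "[ind (x + y) = ind x + ind y] (mod ?p)"
      using cong ind by blast
    then show ?thesis
      unfolding \<psi>_def unity_root_add[symmetric] using unity_root_cong[OF p0] by blast
  qed
  then have "add_char \<psi>"
    by (simp add: add_char_def \<psi>_def)
  moreover have "\<psi> 1 \<noteq> 1"
  proof
    assume "\<psi> 1 = 1"
    then have "?p dvd ind 1"
      using unity_root_eq_1_iff[OF p0] by (simp add: \<psi>_def)
    then have "of_nat (ind 1) = (0::'a)"
      using of_nat_eq_0_iff_char_dvd by blast
    then show False
      using ind[of 1] one by simp
  qed
  ultimately show ?thesis by blast
qed

text \<open>Translation by some \<open>y\<close> in \<open>V\<close> with
  \<open>\<psi> y \<noteq> 1\<close> permutes \<open>V\<close> but multiplies the sum by
  \<open>\<psi> y\<close>, so the sum vanishes.\<close>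

lemma sum_add_char_subgroup:
  assumes V: "add_subgroup V" "finite V" and \<psi>: "add_char \<psi>"
  shows "(\<Sum>x\<in>V. \<psi> x) = (if \<forall>x\<in>V. \<psi> x = 1 then of_nat (card V) else 0)"
proof (cases "\<forall>x\<in>V. \<psi> x = 1")
  case False
  then obtain y where y: "y \<in> V" "\<psi> y \<noteq> 1" by auto
  have "(\<Sum>x\<in>V. \<psi> x) = (\<Sum>x\<in>V. \<psi> (y + x))"
    by (rule sum.reindex_bij_witness[of _ "\<lambda>x. y + x" "\<lambda>x. x - y"])
      (use y V in \<open>auto simp: add_subgroup_add add_subgroup_diff\<close>)
  also have "\<dots> = \<psi> y * (\<Sum>x\<in>V. \<psi> x)"
    by (simp add: add_char_add[OF \<psi>] sum_distrib_left)
  finally have "(\<psi> y - 1) * (\<Sum>x\<in>V. \<psi> x) = 0"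
    by (simp add: algebra_simps)
  then show ?thesis
    using y False by auto
qed simp

section \<open>Annihilators with respect to a nontrivial additive character\<close>

lemma add_subgroup_UNIV: "add_subgroup UNIV"
  by (simp add: add_subgroup_def)

text \<open>Field elements stand for characters, \<open>c\<close> for
  \<open>\<lambda>y. \<psi> (c * y)\<close>; in this reading it is the annihilator of
  \<open>V\<close>.\<close>

definition perp :: "('a::ring \<Rightarrow> complex) \<Rightarrow> 'a set \<Rightarrow> 'a set" where
  "perp \<psi> V = {c. \<forall>y\<in>V. \<psi> (c * y) = 1}"

lemma add_char_scale:
  fixes \<psi> :: "'a::comm_ring \<Rightarrow> complex"
  assumes "add_char \<psi>"
  shows "add_char (\<lambda>x. \<psi> (c * x))" "add_char (\<lambda>x. \<psi> (x * c))"
  using assms by (auto simp: add_char_def algebra_simps)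

lemma add_subgroup_perp: "add_char \<psi> \<Longrightarrow> add_subgroup (perp \<psi> V)"
  by (auto simp: add_subgroup_def perp_def add_char_0 left_diff_distrib add_char_diff)

lemma sum_add_char_UNIV:
  fixes \<psi> :: "'a::{field,finite} \<Rightarrow> complex"
  assumes \<psi>: "add_char \<psi>" "\<psi> z \<noteq> 1"
  shows "(\<Sum>x\<in>UNIV. \<psi> (x * c)) = (if c = 0 then of_nat (card (UNIV::'a set)) else 0)"
proof -
  have "(\<forall>x\<in>UNIV. \<psi> (x * c) = 1) \<longleftrightarrow> c = 0"
  proof
    assume *: "\<forall>x\<in>UNIV. \<psi> (x * c) = 1"
    show "c = 0"
      using *[rule_format, of "z / c"] \<psi>(2) by (cases "c = 0") auto
  qed (simp add: add_char_0[OF \<psi>(1)])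
  then show ?thesis
    using sum_add_char_subgroup[OF add_subgroup_UNIV _ add_char_scale(2)[OF \<psi>(1)], of c] by simp
qed

text \<open>Double count of the sum of \<open>\<psi> (c * y)\<close> over all \<open>c\<close> and
  all \<open>y \<in> V\<close>: summing over \<open>y\<close> first leaves \<open>card V\<close> for
  each \<open>c\<close> in the annihilator, summing over \<open>c\<close> first leaves only
  \<open>y = 0\<close>.\<close>

lemma card_mult_card_perp:
  fixes \<psi> :: "'a::{field,finite} \<Rightarrow> complex"
  assumes \<psi>: "add_char \<psi>" "\<psi> z \<noteq> 1" and V: "add_subgroup V"
  shows "card V * card (perp \<psi> V) = card (UNIV::'a set)"
proof -
  have "(\<Sum>c\<in>UNIV. \<Sum>y\<in>V. \<psi> (c * y)) = (\<Sum>c\<in>UNIV. if c \<in> perp \<psi> V then of_nat (card V) else 0)"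
    using sum_add_char_subgroup[OF V _ add_char_scale(1)[OF \<psi>(1)]] by (simp add: perp_def)
  also have "\<dots> = of_nat (card V * card (perp \<psi> V))"
    by (simp add: sum.If_cases)
  also have "(\<Sum>c\<in>UNIV. \<Sum>y\<in>V. \<psi> (c * y)) = (\<Sum>y\<in>V. \<Sum>c\<in>UNIV. \<psi> (c * y))"
    by (rule sum.swap)
  also have "\<dots> = of_nat (card (UNIV::'a set))"
    using add_subgroup_zero[OF V] by (simp add: sum_add_char_UNIV[OF \<psi>])
  finally show ?thesis
    by (simp only: of_nat_eq_iff)
qed

text \<open>One inclusion is immediate, and the product formula applied twice gives both sides the
  same cardinality.\<close>

lemma perp_perp:
  fixes \<psi> :: "'a::{field,finite} \<Rightarrow> complex"
  assumes \<psi>: "add_char \<psi>" "\<psi> z \<noteq> 1" and V: "add_subgroup V"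
  shows "perp \<psi> (perp \<psi> V) = V"
proof -
  let ?N = "card (UNIV::'a set)"
  have "?N > 0"
    by (simp add: card_gt_0_iff)
  have "card V * card (perp \<psi> V) = ?N" "card (perp \<psi> V) * card (perp \<psi> (perp \<psi> V)) = ?N"
    using card_mult_card_perp[OF \<psi>] V add_subgroup_perp[OF \<psi>(1)] by blast+
  then have "card V = card (perp \<psi> (perp \<psi> V))"
    using \<open>?N > 0\<close> by (metis mult.commute mult_left_cancel mult_is_0 neq0_conv)
  moreover have "V \<subseteq> perp \<psi> (perp \<psi> V)"
    by (auto simp: perp_def mult.commute)
  ultimately show ?thesis
    by (metis card_subset_eq finite)
qed

text \<open>Orthogonality on the annihilator detects membership in its own annihilator, which is
  \<open>V\<close>. This yields the additive part of the sieve.\<close>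

lemma sum_perp_add_char:
  fixes \<psi> :: "'a::{field,finite} \<Rightarrow> complex"
  assumes \<psi>: "add_char \<psi>" "\<psi> z \<noteq> 1" and V: "add_subgroup V"
  shows "(\<Sum>b\<in>perp \<psi> V. \<psi> (b * x)) = (if x \<in> V then of_nat (card (perp \<psi> V)) else 0)"
proof -
  have "(\<forall>b\<in>perp \<psi> V. \<psi> (b * x) = 1) \<longleftrightarrow> x \<in> perp \<psi> (perp \<psi> V)"
    by (auto simp: perp_def mult.commute)
  then show ?thesis
    using sum_add_char_subgroup[OF add_subgroup_perp[OF \<psi>(1)] _ add_char_scale(2)[OF \<psi>(1)], of V x]
    by (simp add: perp_perp[OF \<psi> V])
qed

section \<open>Multiplicative characters and Gauss sums\<close>

text \<open>With the value \<open>0\<close> at \<open>0\<close>, also for the trivial character,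
  sums over \<open>UNIV\<close> agree with sums over the multiplicative group.\<close>

definition mult_char :: "('a::field \<Rightarrow> complex) \<Rightarrow> bool" where
  "mult_char \<chi> \<longleftrightarrow> \<chi> 0 = 0 \<and> (\<forall>x y. \<chi> (x * y) = \<chi> x * \<chi> y) \<and> (\<forall>x. x \<noteq> 0 \<longrightarrow> norm (\<chi> x) = 1)"

lemma sum_mult_char:
  fixes \<chi> :: "'a::{field,finite} \<Rightarrow> complex"
  assumes \<chi>: "mult_char \<chi>" and z: "z \<noteq> 0" "\<chi> z \<noteq> 1"
  shows "(\<Sum>x\<in>UNIV. \<chi> x) = 0"
proof -
  have "(\<Sum>x\<in>UNIV. \<chi> x) = (\<Sum>x\<in>UNIV. \<chi> (z * x))"
    by (rule sum.reindex_bij_witness[of _ "\<lambda>x. z * x" "\<lambda>x. x / z"]) (use z in auto)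
  also have "\<dots> = \<chi> z * (\<Sum>x\<in>UNIV. \<chi> x)"
    using \<chi> by (simp add: mult_char_def sum_distrib_left)
  finally have "(\<chi> z - 1) * (\<Sum>x\<in>UNIV. \<chi> x) = 0"
    by (simp add: algebra_simps)
  then show ?thesis
    using z by simp
qed

lemma gauss_sum_bound:
  fixes \<chi> \<psi> :: "'a::{field,finite} \<Rightarrow> complex"
  assumes \<chi>: "mult_char \<chi>" and \<psi>: "add_char \<psi>" "\<psi> z \<noteq> 1" and a: "a \<noteq> 0"
  shows "norm (\<Sum>x\<in>UNIV. \<chi> x * \<psi> (a * x)) \<le> sqrt (card (UNIV::'a set))"
proof -
  let ?N = "card (UNIV::'a set)"
  define G where "G a = (\<Sum>x\<in>UNIV. \<chi> x * \<psi> (a * x))" for a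
  \<comment> \<open>\<open>\<bar>G a\<bar>\<close> does not depend on \<open>a \<noteq> 0\<close>, so it is at most its root mean square.\<close>
  have G: "norm (G a) = norm (G 1)" if "a \<noteq> 0" for a
  proof -
    have "G 1 = (\<Sum>x\<in>UNIV. \<chi> (a * x) * \<psi> (a * x))"
      unfolding G_def
      by (rule sum.reindex_bij_witness[of _ "\<lambda>x. a * x" "\<lambda>x. x / a"]) (use that in auto)
    also have "\<dots> = \<chi> a * G a"
      using \<chi> by (simp add: mult_char_def G_def sum_distrib_left mult.assoc)
    finally show ?thesis
      using \<chi> that by (simp add: mult_char_def norm_mult)
  qed
  have nz: "card (UNIV - {0::'a}) = ?N - 1"
    by simp
  have "(1::'a) \<in> UNIV - {0}" by simp
  then have pos: "?N - 1 > 0"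
    unfolding nz[symmetric] by (metis card_gt_0_iff emptyE finite)
  \<comment> \<open>The squared norm is expanded into a double sum over \<open>x\<close> and
    \<open>y\<close>; summing over \<open>a\<close> first leaves only the diagonal
    \<open>x = y\<close>.\<close>
  have "complex_of_real (\<Sum>a\<in>UNIV. (norm (G a))\<^sup>2) = (\<Sum>a\<in>UNIV. G a * cnj (G a))"
    by (simp only: of_real_sum complex_norm_square)
  also have "\<dots> = (\<Sum>a\<in>UNIV. \<Sum>x\<in>UNIV. \<Sum>y\<in>UNIV. (\<chi> x * cnj (\<chi> y)) * \<psi> (a * (x - y)))"
    unfolding G_def cnj_sum sum_product
    by (intro sum.cong refl)
      (simp add: right_diff_distrib add_char_diff[OF \<psi>(1)] mult_ac)
  also have "\<dots> = (\<Sum>x\<in>UNIV. \<Sum>y\<in>UNIV. \<Sum>a\<in>UNIV. (\<chi> x * cnj (\<chi> y)) * \<psi> (a * (x - y)))"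
    by (subst sum.swap) (rule sum.cong[OF refl sum.swap])
  also have "\<dots> = (\<Sum>x\<in>UNIV. \<Sum>y\<in>UNIV. if y = x then (\<chi> x * cnj (\<chi> x)) * of_nat ?N else 0)"
    by (intro sum.cong refl) (auto simp: sum_distrib_left[symmetric] sum_add_char_UNIV[OF \<psi>])
  also have "\<dots> = (\<Sum>x\<in>UNIV. of_real ((norm (\<chi> x))\<^sup>2) * of_nat ?N)"
    unfolding complex_norm_square by simp
  also have "\<dots> = (\<Sum>x\<in>UNIV - {0}. of_real ((norm (\<chi> x))\<^sup>2) * of_nat ?N)"
    by (rule sum.mono_neutral_right) (use \<chi> in \<open>auto simp: mult_char_def\<close>)
  also have "\<dots> = (\<Sum>x\<in>UNIV - {0::'a}. of_nat ?N)"
    by (intro sum.cong refl) (use \<chi> in \<open>auto simp: mult_char_def\<close>)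
  also have "\<dots> = of_real (real (?N - 1) * real ?N)"
    using nz by simp
  finally have "(\<Sum>a\<in>UNIV. (norm (G a))\<^sup>2) = real (?N - 1) * real ?N"
    by (simp only: of_real_eq_iff)
  \<comment> \<open>Dropping the term \<open>a = 0\<close> leaves \<open>?N - 1\<close> equal terms;
    this costs equality but covers the trivial character too.\<close>
  moreover have "(\<Sum>a\<in>UNIV - {0}. (norm (G a))\<^sup>2) \<le> (\<Sum>a\<in>UNIV. (norm (G a))\<^sup>2)"
    by (rule sum_mono2) auto
  moreover have "(\<Sum>a\<in>UNIV - {0}. (norm (G a))\<^sup>2) = (\<Sum>a\<in>UNIV - {0::'a}. (norm (G 1))\<^sup>2)"
    by (intro sum.cong refl arg_cong[of _ _ "\<lambda>x. x\<^sup>2"] G) simp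
  ultimately have "real (?N - 1) * (norm (G 1))\<^sup>2 \<le> real (?N - 1) * real ?N"
    using nz by simp
  then have "(norm (G 1))\<^sup>2 \<le> real ?N"
    using pos by (metis mult_le_cancel_left_pos of_nat_0_less_iff)
  then show ?thesis
    using G[OF a] by (simp add: G_def real_le_rsqrt)
qed

section \<open>Character sums twisted by an additive map\<close>

definition additive_map :: "('a::ab_group_add \<Rightarrow> 'b::ab_group_add) \<Rightarrow> bool" where
  "additive_map L \<longleftrightarrow> (\<forall>x y. L (x + y) = L x + L y)"

lemma additive_map_diff:
  assumes "additive_map L"
  shows "L (x - y) = L x - L y"
  using assms[unfolded additive_map_def, rule_format, of "x - y" y] by simp

lemma additive_map_0: "additive_map L \<Longrightarrow> L 0 = 0"
  using additive_map_diff[of L 0 0] by simp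

lemma add_subgroup_range: "additive_map L \<Longrightarrow> add_subgroup (range L)"
  by (auto simp: add_subgroup_def simp flip: additive_map_diff intro!: range_eqI[of _ _ 0] additive_map_0[symmetric])

lemma add_subgroup_kernel: "additive_map L \<Longrightarrow> add_subgroup {x. L x = 0}"
  by (simp add: add_subgroup_def additive_map_diff additive_map_0)

text \<open>Every nonempty fibre is a translate of the kernel.\<close>

lemma card_kernel_mult_card_range:
  fixes L :: "'a::{ab_group_add,finite} \<Rightarrow> 'b::ab_group_add"
  assumes L: "additive_map L"
  shows "card {x. L x = 0} * card (range L) = card (UNIV::'a set)"
proof -
  have fibre: "card {x. L x = y} = card {x. L x = 0}" if y: "y \<in> range L" for y
  proof -
    obtain z where z: "y = L z" using y by blast
    show ?thesis
      by (rule bij_betw_same_card[of "\<lambda>x. x - z"], rule bij_betwI[of _ _ _ "\<lambda>x. x + z"])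
        (use L in \<open>auto simp: z additive_map_diff, simp add: additive_map_def\<close>)
  qed
  have "card (UNIV::'a set) = card (\<Union>y\<in>range L. {x. L x = y})"
    by (rule arg_cong[of _ _ card]) auto
  also have "\<dots> = (\<Sum>y\<in>range L. card {x. L x = y})"
    by (rule card_UN_disjoint) auto
  also have "\<dots> = card {x. L x = 0} * card (range L)"
    using fibre by simp
  finally show ?thesis by simp
qed

text \<open>In the Fourier expansion of \<open>\<chi>\<close> every coefficient is a Gauss sum.
  After substituting \<open>L x\<close> and summing over \<open>x\<close>, only those
  \<open>c\<close> survive for which \<open>\<psi> (c * L x + b * x)\<close> is identically
  \<open>1\<close>. They lie in one coset of the annihilator of \<open>range L\<close>, whose size
  is that of the kernel.\<close>

lemma twisted_char_sum_bound:
  fixes \<chi> \<psi> :: "'a::{field,finite} \<Rightarrow> complex"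
  assumes \<chi>: "mult_char \<chi>" and w: "w \<noteq> 0" "\<chi> w \<noteq> 1"
    and \<psi>: "add_char \<psi>" "\<psi> z \<noteq> 1" and L: "additive_map L"
  shows "norm (\<Sum>x\<in>UNIV. \<chi> (L x) * \<psi> (b * x)) \<le> card {x. L x = 0} * sqrt (card (UNIV::'a set))"
proof -
  let ?N = "card (UNIV::'a set)"
  have N: "?N > 0"
    by (simp add: card_gt_0_iff)
  \<comment> \<open>Up to the factor \<open>?N\<close> this is the Fourier coefficient of
    \<open>\<chi>\<close> at \<open>c\<close>; the minus sign comes from conjugating the
    character.\<close>
  define G where "G c = (\<Sum>x\<in>UNIV. \<chi> x * \<psi> (- c * x))" for c
  have normG: "norm (G c) \<le> sqrt ?N" for c
  \<comment> \<open>Nontriviality of \<open>\<chi>\<close> makes the coefficient at \<open>0\<close>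
    vanish, a case that the Gauss sum bound does not cover.\<close>
  proof (cases "c = 0")
    case True
    then have "G c = 0"
      using sum_mult_char[OF \<chi> w] by (simp add: G_def add_char_0[OF \<psi>(1)])
    then show ?thesis by simp
  next
    case False
    then show ?thesis
      unfolding G_def by (intro gauss_sum_bound[OF \<chi> \<psi>]) simp
  qed
  have inversion: "of_nat ?N * \<chi> y = (\<Sum>c\<in>UNIV. G c * \<psi> (c * y))" for y
  proof -
    have "(\<Sum>c\<in>UNIV. G c * \<psi> (c * y)) = (\<Sum>c\<in>UNIV. \<Sum>x\<in>UNIV. \<chi> x * \<psi> (c * (y - x)))"
      unfolding G_def sum_distrib_right
      by (intro sum.cong refl)
        (simp add: right_diff_distrib add_char_diff[OF \<psi>(1)] add_char_uminus[OF \<psi>(1)] mult_ac)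
    also have "\<dots> = (\<Sum>x\<in>UNIV. \<chi> x * (\<Sum>c\<in>UNIV. \<psi> (c * (y - x))))"
      by (subst sum.swap) (simp add: sum_distrib_left)
    also have "\<dots> = (\<Sum>x\<in>UNIV. if x = y then \<chi> y * of_nat ?N else 0)"
      by (intro sum.cong refl) (auto simp: sum_add_char_UNIV[OF \<psi>])
    finally show ?thesis by simp
  qed
  define A where "A = {c. \<forall>x. \<psi> (c * L x + b * x) = 1}"
  have "of_nat ?N * (\<Sum>x\<in>UNIV. \<chi> (L x) * \<psi> (b * x))
      = (\<Sum>x\<in>UNIV. \<Sum>c\<in>UNIV. G c * \<psi> (c * L x + b * x))"
    unfolding sum_distrib_left mult.assoc[symmetric] inversion add_char_add[OF \<psi>(1)] sum_distrib_right ..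
  also have "\<dots> = (\<Sum>c\<in>UNIV. G c * (\<Sum>x\<in>UNIV. \<psi> (c * L x + b * x)))"
    by (subst sum.swap) (simp add: sum_distrib_left)
  also have "\<dots> = (\<Sum>c\<in>UNIV. if c \<in> A then G c * of_nat ?N else 0)"
  proof (intro sum.cong refl)
    fix c
    have "add_char (\<lambda>x. \<psi> (c * L x + b * x))"
      using \<psi>(1) L by (simp add: add_char_def additive_map_def algebra_simps norm_mult)
    then show "G c * (\<Sum>x\<in>UNIV. \<psi> (c * L x + b * x)) = (if c \<in> A then G c * of_nat ?N else 0)"
      using sum_add_char_subgroup[OF add_subgroup_UNIV, of "\<lambda>x. \<psi> (c * L x + b * x)"] by (simp add: A_def)
  qed
  also have "\<dots> = of_nat ?N * (\<Sum>c\<in>A. G c)"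
    by (simp add: sum.If_cases sum_distrib_left) (simp add: mult.commute)
  finally have "(\<Sum>x\<in>UNIV. \<chi> (L x) * \<psi> (b * x)) = (\<Sum>c\<in>A. G c)"
    using N by simp
  also have "norm \<dots> \<le> (\<Sum>c\<in>A. norm (G c))"
    by (rule norm_sum)
  also have "\<dots> \<le> card A * sqrt ?N"
    using normG by (simp add: sum_bounded_above)
  also have "card A \<le> card {x. L x = 0}"
  proof (cases "A = {}")
    case False
    then obtain c0 where c0: "c0 \<in> A" by auto
    \<comment> \<open>The term \<open>b * x\<close> cancels in the difference of two members of
      \<open>A\<close>.\<close>
    have "(\<lambda>c. c - c0) ` A \<subseteq> perp \<psi> (range L)"
    proof clarify
      fix c assume "c \<in> A"
      then have "\<psi> ((c * L x + b * x) - (c0 * L x + b * x)) = 1" for x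
        using c0 by (subst add_char_diff[OF \<psi>(1)]) (simp add: A_def)
      then show "c - c0 \<in> perp \<psi> (range L)"
        by (simp add: perp_def algebra_simps)
    qed
    then have "card A \<le> card (perp \<psi> (range L))"
      by (intro card_inj_on_le[of "\<lambda>c. c - c0"]) (auto simp: inj_on_def)
    also have "card (perp \<psi> (range L)) = card {x. L x = 0}"
    proof -
      have "card (range L) * card (perp \<psi> (range L)) = card (range L) * card {x. L x = 0}"
        using card_mult_card_perp[OF \<psi> add_subgroup_range[OF L]] card_kernel_mult_card_range[OF L]
        by (simp add: mult.commute)
      then show ?thesis by simp
    qed
    finally show ?thesis .
  qed simp
  then have "card A * sqrt ?N \<le> card {x. L x = 0} * sqrt ?N"
    by (intro mult_right_mono) auto
  finally show ?thesis
    by simp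
qed

section \<open>A sieve for averages of characters\<close>

text \<open>That \<open>u\<close> is a convex combination of the functions in \<open>C\<close>, expressed by its effect on bounds of
  linear functionals; in this form it is inherited by products without tracking weights.\<close>

definition averages :: "('a::finite \<Rightarrow> complex) \<Rightarrow> ('a \<Rightarrow> complex) set \<Rightarrow> bool" where
  "averages u C \<longleftrightarrow> (\<forall>\<phi> B. (\<forall>c\<in>C. norm (\<Sum>x\<in>UNIV. c x * \<phi> x) \<le> B) \<longrightarrow>
     norm (\<Sum>x\<in>UNIV. u x * \<phi> x) \<le> B)"

lemma averages_mean:
  assumes T: "finite T" "T \<noteq> {}"
  shows "averages (\<lambda>x. (\<Sum>t\<in>T. c t x) / of_nat (card T)) (c ` T)"
  unfolding averages_def
proof (intro allI impI)
  fix \<phi> :: "'b \<Rightarrow> complex" and B :: real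
  assume *: "\<forall>c\<in>c ` T. norm (\<Sum>x\<in>UNIV. c x * \<phi> x) \<le> B"
  have pos: "card T > 0"
    using T by (simp add: card_gt_0_iff)
  have "(\<Sum>x\<in>UNIV. (\<Sum>t\<in>T. c t x) / of_nat (card T) * \<phi> x)
      = (\<Sum>x\<in>UNIV. \<Sum>t\<in>T. c t x * \<phi> x) / of_nat (card T)"
    by (simp add: sum_distrib_right sum_divide_distrib)
  also have "\<dots> = (\<Sum>t\<in>T. \<Sum>x\<in>UNIV. c t x * \<phi> x) / of_nat (card T)"
    by (subst sum.swap) (rule refl)
  also have "norm \<dots> = norm (\<Sum>t\<in>T. \<Sum>x\<in>UNIV. c t x * \<phi> x) / real (card T)"
    by (simp add: norm_divide)
  also have "\<dots> \<le> (real (card T) * B) / real (card T)"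
  proof (rule divide_right_mono)
    have "norm (\<Sum>t\<in>T. \<Sum>x\<in>UNIV. c t x * \<phi> x) \<le> (\<Sum>t\<in>T. norm (\<Sum>x\<in>UNIV. c t x * \<phi> x))"
      by (rule norm_sum)
    also have "\<dots> \<le> real (card T) * B"
      using * by (intro sum_bounded_above) auto
    finally show "norm (\<Sum>t\<in>T. \<Sum>x\<in>UNIV. c t x * \<phi> x) \<le> real (card T) * B" .
  qed simp
  also have "\<dots> = B"
    using pos by simp
  finally show "norm (\<Sum>x\<in>UNIV. (\<Sum>t\<in>T. c t x) / of_nat (card T) * \<phi> x) \<le> B" .
qed

text \<open>The averages are replaced by members of the \<open>C i\<close> one at a time. The
  remaining factors are absorbed into the weight, hence the induction with arbitrary
  \<open>\<phi>\<close>.\<close>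

lemma averages_prod:
  assumes "finite J" "\<And>i. i \<in> J \<Longrightarrow> averages (u i) (C i)"
    and "\<And>f. (\<And>i. i \<in> J \<Longrightarrow> f i \<in> C i) \<Longrightarrow> norm (\<Sum>x\<in>UNIV. (\<Prod>i\<in>J. f i x) * \<phi> x) \<le> B"
  shows "norm (\<Sum>x\<in>UNIV. (\<Prod>i\<in>J. u i x) * \<phi> x) \<le> B"
  using assms
proof (induction J arbitrary: \<phi> rule: finite_induct)
  case empty
  then show ?case by simp
next
  case (insert j J)
  have "norm (\<Sum>x\<in>UNIV. c x * ((\<Prod>i\<in>J. u i x) * \<phi> x)) \<le> B" if c: "c \<in> C j" for c
  proof -
    have "norm (\<Sum>x\<in>UNIV. (\<Prod>i\<in>J. u i x) * (c x * \<phi> x)) \<le> B"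
    proof (rule insert.IH)
      fix f assume f: "\<And>i. i \<in> J \<Longrightarrow> f i \<in> C i"
      have "(\<Prod>i\<in>insert j J. (f(j := c)) i x) = c x * (\<Prod>i\<in>J. f i x)" for x
        using insert.hyps by (simp, intro disjI2 prod.cong) auto
      moreover have "norm (\<Sum>x\<in>UNIV. (\<Prod>i\<in>insert j J. (f(j := c)) i x) * \<phi> x) \<le> B"
        by (rule insert.prems(2)) (use f c in auto)
      ultimately show "norm (\<Sum>x\<in>UNIV. (\<Prod>i\<in>J. f i x) * (c x * \<phi> x)) \<le> B"
        by (simp add: mult_ac)
    qed (use insert.prems in auto)
    then show ?thesis by (simp add: mult_ac)
  qed
  then have "norm (\<Sum>x\<in>UNIV. u j x * ((\<Prod>i\<in>J. u i x) * \<phi> x)) \<le> B"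
    using insert.prems(1)[of j] by (auto simp: averages_def)
  then show ?case
    using insert.hyps by (simp add: mult.assoc)
qed

lemma prod_one_minus_expand:
  fixes f :: "'i \<Rightarrow> 'a::comm_ring_1"
  assumes "finite I"
  shows "(\<Prod>i\<in>I. 1 - f i) = (\<Sum>J\<in>Pow I. (-1) ^ card J * (\<Prod>i\<in>J. f i))"
  using prod_diff_conv_sum[OF assms, of "\<lambda>_. 1" f] by simp

text \<open>Expanding the product over subsets \<open>J\<close> of \<open>I\<close>, the empty set
  gives the main term and each of the \<open>2 ^ card I - 1\<close> others contributes a sum of norm
  at most \<open>B\<close>.\<close>

lemma character_sieve:
  fixes u :: "'i \<Rightarrow> 'a::finite \<Rightarrow> complex"
  assumes I: "finite I" and avg: "\<And>i. i \<in> I \<Longrightarrow> averages (u i) (C i)"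
    and bound: "\<And>J f. J \<subseteq> I \<Longrightarrow> J \<noteq> {} \<Longrightarrow> (\<And>i. i \<in> J \<Longrightarrow> f i \<in> C i) \<Longrightarrow>
      norm (\<Sum>x\<in>UNIV. (\<Prod>i\<in>J. f i x) * h x) \<le> B"
  shows "norm ((\<Sum>x\<in>UNIV. (\<Prod>i\<in>I. 1 - u i x) * h x) - (\<Sum>x\<in>UNIV. h x)) \<le> (2 ^ card I - 1) * B"
proof -
  have "(\<Sum>x\<in>UNIV. (\<Prod>i\<in>I. 1 - u i x) * h x)
      = (\<Sum>J\<in>Pow I. (-1) ^ card J * (\<Sum>x\<in>UNIV. (\<Prod>i\<in>J. u i x) * h x))"
    unfolding prod_one_minus_expand[OF I] sum_distrib_right sum_distrib_left
    by (subst sum.swap) (simp add: mult.assoc)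
  also have "\<dots> = (\<Sum>x\<in>UNIV. h x)
      + (\<Sum>J\<in>Pow I - {{}}. (-1) ^ card J * (\<Sum>x\<in>UNIV. (\<Prod>i\<in>J. u i x) * h x))"
    by (subst sum.remove[of _ "{}"]) (use I in auto)
  finally have "(\<Sum>x\<in>UNIV. (\<Prod>i\<in>I. 1 - u i x) * h x) - (\<Sum>x\<in>UNIV. h x)
      = (\<Sum>J\<in>Pow I - {{}}. (-1) ^ card J * (\<Sum>x\<in>UNIV. (\<Prod>i\<in>J. u i x) * h x))"
    by simp
  also have "norm \<dots> \<le> (\<Sum>J\<in>Pow I - {{}}. norm ((-1) ^ card J * (\<Sum>x\<in>UNIV. (\<Prod>i\<in>J. u i x) * h x)))"
    by (rule norm_sum)
  also have "\<dots> \<le> real (card (Pow I - {{}})) * B"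
  proof (rule sum_bounded_above)
    fix J assume J: "J \<in> Pow I - {{}}"
    have "norm (\<Sum>x\<in>UNIV. (\<Prod>i\<in>J. u i x) * h x) \<le> B"
      by (rule averages_prod[where C = C]) (use J avg bound I in \<open>auto intro: finite_subset\<close>)
    then show "norm ((-1) ^ card J * (\<Sum>x\<in>UNIV. (\<Prod>i\<in>J. u i x) * h x)) \<le> B"
      by (simp add: norm_mult norm_power)
  qed
  also have "real (card (Pow I - {{}})) = 2 ^ card I - 1"
    using I by (simp add: card_Pow of_nat_diff)
  finally show ?thesis .
qed

section \<open>Primitive roots\<close>

text \<open>The type is wrapped in the record \<open>R\<close>, so that the cyclicity of the
  multiplicative group and Lagrange's theorem from HOL-Algebra apply; both are then read back as
  statements about powers.\<close>

lemma finite_field_generator: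
  obtains g :: "'a::{field,finite}" where "range (\<lambda>i::nat. g ^ i) = UNIV - {0}"
    "\<And>x::'a. x \<noteq> 0 \<Longrightarrow> x ^ (card (UNIV::'a set) - 1) = 1"
proof -
  define R :: "'a ring"
    where "R = \<lparr>carrier = UNIV, monoid.mult = (*), one = 1, ring.zero = 0, add = (+)\<rparr>"
  interpret R: field R
  proof -
    have "\<exists>y. x + y = 0" "\<exists>y. y + x = 0" for x :: 'a
      by (auto intro: exI[of _ "- x"])
    moreover have "x \<noteq> 0 \<Longrightarrow> \<exists>y. x * y = 1" for x :: 'a
      by (rule exI[of _ "inverse x"]) auto
    ultimately show "field R"
      unfolding R_def by unfold_locales (auto simp: algebra_simps Units_def)
  qed
  have carrier: "carrier (mult_of R) = UNIV - {0}"
    by (simp add: R_def)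
  have pow: "x [^]\<^bsub>R\<^esub> (i::nat) = x ^ i" for x i
    by (induction i) (auto simp: R_def nat_pow_def mult.commute)
  obtain g where "carrier (mult_of R) = {g [^]\<^bsub>R\<^esub> i | i::nat. i \<in> UNIV}"
    using R.finite_field_mult_group_has_gen by auto
  then have "range (\<lambda>i::nat. g ^ i) = UNIV - {0}"
    unfolding carrier pow by auto
  moreover have "x ^ (card (UNIV::'a set) - 1) = 1" if "x \<noteq> 0" for x :: 'a
  proof -
    have "x [^]\<^bsub>mult_of R\<^esub> Coset.order (mult_of R) = \<one>\<^bsub>mult_of R\<^esub>"
      by (rule group.pow_order_eq_1[OF R.field_mult_group]) (use that carrier in auto)
    then show ?thesis
      unfolding nat_pow_mult_of pow Coset.order_def carrier by (simp add: R_def)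
  qed
  ultimately show ?thesis
    using that by blast
qed


lemma finite_field_power_card:
  fixes x :: "'a::{field,finite}"
  shows "x ^ card (UNIV::'a set) = x"
proof (cases "x = 0")
  case True
  then show ?thesis by (simp add: card_gt_0_iff)
next
  case False
  obtain N where N: "card (UNIV::'a set) = Suc N"
    using card_gt_0_iff[of "UNIV::'a set"] by (metis UNIV_not_empty finite gr0_implies_Suc)
  show ?thesis
    using finite_field_generator[where ?'a = 'a] False unfolding N by (metis diff_Suc_1 mult.right_neutral power_Suc)
qed

locale primitive_root =
  fixes g :: "'a::{field,finite}" and M :: nat
  assumes gen: "range (\<lambda>i::nat. g ^ i) = UNIV - {0}"
    and M: "M = card (UNIV::'a set) - 1"
begin

text \<open>The discrete logarithm to base \<open>g\<close>, determined only modulo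
  \<open>M\<close>; its value at \<open>0\<close> is arbitrary.\<close>

definition ind :: "'a \<Rightarrow> nat" where
  "ind x = (SOME i. g ^ i = x)"

lemma power_ind: "x \<noteq> 0 \<Longrightarrow> g ^ ind x = x"
  unfolding ind_def by (rule someI_ex) (use gen in \<open>metis (mono_tags) Diff_iff UNIV_I imageE singletonD\<close>)

lemma gen_nonzero [simp]: "g \<noteq> 0"
  using gen by (metis DiffD2 power_one_right rangeI singletonI)

lemma M_eq: "card (UNIV - {0::'a}) = M"
  by (simp add: M)

lemma M_pos: "M > 0"
proof -
  have "(1::'a) \<in> UNIV - {0}" by simp
  then show ?thesis
    unfolding M_eq[symmetric] by (metis card_gt_0_iff emptyE finite)
qed

lemma gen_power_M: "g ^ M = 1"
  unfolding M using finite_field_generator[where ?'a = 'a] gen_nonzero by metis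

lemma gen_power_mod: "g ^ (i mod M) = g ^ i"
proof -
  have "g ^ i = g ^ (M * (i div M)) * g ^ (i mod M)"
    by (metis mult_div_mod_eq power_add)
  then show ?thesis
    by (simp add: power_mult gen_power_M)
qed

text \<open>The \<open>M\<close> exponents below \<open>M\<close> already reach all \<open>M\<close>
  nonzero elements, so distinct ones give distinct powers.\<close>

lemma gen_power_eq_iff: "g ^ i = g ^ j \<longleftrightarrow> [i = j] (mod M)"
proof
  assume "[i = j] (mod M)"
  then show "g ^ i = g ^ j"
    by (metis cong_def gen_power_mod)
next
  assume eq: "g ^ i = g ^ j"
  have "(\<lambda>i. g ^ i) ` {..<M} = UNIV - {0}"
  proof
    show "UNIV - {0} \<subseteq> (\<lambda>i. g ^ i) ` {..<M}"
    proof
      fix x assume "x \<in> UNIV - {0::'a}"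
      then obtain k where "x = g ^ k"
        using gen by auto
      then have "x = g ^ (k mod M)"
        by (simp add: gen_power_mod)
      then show "x \<in> (\<lambda>i. g ^ i) ` {..<M}"
        using M_pos by (intro image_eqI[of _ _ "k mod M"]) auto
    qed
  qed auto
  then have "inj_on (\<lambda>i. g ^ i) {..<M}"
    by (intro eq_card_imp_inj_on) (simp_all add: M_eq)
  moreover have "g ^ (i mod M) = g ^ (j mod M)"
    using eq by (simp add: gen_power_mod)
  ultimately show "[i = j] (mod M)"
    unfolding cong_def using M_pos by (meson inj_onD lessThan_iff mod_less_divisor)
qed

lemma ind_mult:
  assumes "x \<noteq> 0" "y \<noteq> 0"
  shows "[ind (x * y) = ind x + ind y] (mod M)"
proof -
  have "g ^ ind (x * y) = g ^ (ind x + ind y)"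
    using assms by (simp add: power_ind power_add)
  then show ?thesis
    by (simp only: gen_power_eq_iff)
qed

lemma ind_gen_power: "[ind (g ^ i) = i] (mod M)"
  unfolding gen_power_eq_iff[symmetric] by (rule power_ind) simp

text \<open>An exponent \<open>j\<close> with \<open>x ^ j = g\<close> is the same as an inverse of
  \<open>ind x\<close> modulo \<open>M\<close>.\<close>

lemma primitive_elt_iff_coprime:
  assumes x: "x \<noteq> 0"
  shows "primitive_elt x \<longleftrightarrow> coprime (ind x) M"
proof
  assume "primitive_elt x"
  then have "g \<in> range (\<lambda>j::nat. x ^ j)"
    by (simp add: primitive_elt_def)
  then obtain j where "g = x ^ j"
    by blast
  then have "g ^ 1 = g ^ (ind x * j)"
    using power_ind[OF x] by (simp add: power_mult)
  then have "[ind x * j = 1] (mod M)"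
    unfolding gen_power_eq_iff by (rule cong_sym)
  then show "coprime (ind x) M"
    using coprime_iff_invertible_nat by auto
next
  assume "coprime (ind x) M"
  then obtain j where j: "[ind x * j = 1] (mod M)"
    using cong_solve_coprime_nat by auto
  have "y \<in> range (\<lambda>j. x ^ j)" if y: "y \<noteq> 0" for y
  proof -
    have "[ind x * j * ind y = 1 * ind y] (mod M)"
      using j by (rule cong_scalar_right)
    then have "g ^ (ind x * (j * ind y)) = g ^ ind y"
      unfolding gen_power_eq_iff by (simp add: mult.assoc)
    then have "x ^ (j * ind y) = y"
      by (simp only: power_mult power_ind[OF x] power_ind[OF y])
    then show ?thesis by (metis rangeI)
  qed
  then show "primitive_elt x"
    unfolding primitive_elt_def using x by auto
qed

text \<open>For a prime \<open>p\<close> dividing \<open>M\<close>, \<open>p dvd ind x\<close> says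
  that \<open>x\<close> is a \<open>p\<close>-th power; these are the multiplicative obstructions of
  the sieve.\<close>

lemma primitive_elt_iff:
  assumes x: "x \<noteq> 0"
  shows "primitive_elt x \<longleftrightarrow> (\<forall>p\<in>prime_factors M. \<not> p dvd ind x)"
proof -
  have "coprime (ind x) M \<longleftrightarrow> (\<forall>p\<in>prime_factors M. \<not> p dvd ind x)"
  proof
    assume "coprime (ind x) M"
    then show "\<forall>p\<in>prime_factors M. \<not> p dvd ind x"
      by (metis coprime_common_divisor in_prime_factors_iff not_prime_unit)
  next
    assume *: "\<forall>p\<in>prime_factors M. \<not> p dvd ind x"
    show "coprime (ind x) M"
    proof (rule ccontr)
      assume "\<not> coprime (ind x) M"
      then have "gcd (ind x) M \<noteq> 1"
        by (simp add: coprime_iff_gcd_eq_1)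
      then obtain p where "prime p" "p dvd gcd (ind x) M"
        using prime_factor_nat by blast
      then show False
        using * M_pos by (auto simp: in_prime_factors_iff)
    qed
  qed
  then show ?thesis
    by (simp add: primitive_elt_iff_coprime[OF x])
qed

text \<open>For a prime \<open>p\<close> dividing \<open>M\<close> and \<open>0 < t p < p\<close>
  the factor at \<open>p\<close> is a character of exact order \<open>p\<close>. An empty
  \<open>S\<close> gives the trivial character.\<close>

definition prod_char :: "nat set \<Rightarrow> (nat \<Rightarrow> nat) \<Rightarrow> 'a \<Rightarrow> complex" where
  "prod_char S t x = (if x = 0 then 0 else \<Prod>p\<in>S. unity_root p (t p * ind x))"

lemma mult_char_prod_char:
  assumes S: "S \<subseteq> prime_factors M"
  shows "mult_char (prod_char S t)"
proof -
  have "unity_root p (t p * ind (x * y)) = unity_root p (t p * ind x) * unity_root p (t p * ind y)"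
    if p: "p \<in> S" and xy: "x \<noteq> 0" "y \<noteq> 0" for p x y
  proof -
    have p': "p dvd M" "p > 0"
      using S p by (auto simp: in_prime_factors_iff prime_gt_0_nat)
    have "[t p * ind (x * y) = t p * (ind x + ind y)] (mod p)"
      using cong_dvd_modulus_nat[OF ind_mult[OF xy] p'(1)] by (rule cong_scalar_left)
    then show ?thesis
      using unity_root_cong[OF p'(2)] by (simp add: distrib_left unity_root_add)
  qed
  then show ?thesis
    by (simp add: mult_char_def prod_char_def prod_norm[symmetric] flip: prod.distrib)
qed

text \<open>Raising \<open>g\<close> to the product of all primes of \<open>S\<close> except one,
  \<open>p0\<close>, trivialises every factor but the one at \<open>p0\<close>.\<close>

lemma prod_char_nontrivial:
  assumes S: "S \<subseteq> prime_factors M" "S \<noteq> {}" and t: "\<And>p. p \<in> S \<Longrightarrow> 0 < t p \<and> t p < p"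
  shows "\<exists>w. w \<noteq> 0 \<and> prod_char S t w \<noteq> 1"
proof -
  obtain p0 where p0: "p0 \<in> S" using S by auto
  have fin: "finite S" using S finite_subset by blast
  have pr: "prime p" "p dvd M" if "p \<in> S" for p
    using S that by (auto simp: in_prime_factors_iff)
  define m where "m = \<Prod>(S - {p0})"
  have val: "unity_root p (t p * ind (g ^ m)) = 1 \<longleftrightarrow> p dvd m" if p: "p \<in> S" for p
  proof -
    have "[ind (g ^ m) = m] (mod p)"
      using cong_dvd_modulus_nat[OF ind_gen_power pr(2)[OF p]] .
    then have "p dvd ind (g ^ m) \<longleftrightarrow> p dvd m"
      by (rule cong_dvd_iff)
    moreover have "\<not> p dvd t p"
      using t[OF p] by (auto dest: dvd_imp_le)
    ultimately show ?thesis
      using pr(1)[OF p] by (simp add: unity_root_eq_1_iff prime_gt_0_nat prime_dvd_mult_iff)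
  qed
  have "prod_char S t (g ^ m) = unity_root p0 (t p0 * ind (g ^ m)) * (\<Prod>p\<in>S - {p0}. unity_root p (t p * ind (g ^ m)))"
    by (simp add: prod_char_def prod.remove[OF fin p0])
  also have "(\<Prod>p\<in>S - {p0}. unity_root p (t p * ind (g ^ m))) = 1"
  proof (rule prod.neutral, rule ballI)
    fix p assume p: "p \<in> S - {p0}"
    then have "p dvd m"
      unfolding m_def using fin by (intro dvd_prodI) auto
    then show "unity_root p (t p * ind (g ^ m)) = 1"
      using val p by blast
  qed
  finally have "prod_char S t (g ^ m) = unity_root p0 (t p0 * ind (g ^ m))" by simp
  moreover have "\<not> p0 dvd m"
  proof
    assume "p0 dvd m"
    then obtain p where "p \<in> S - {p0}" "p0 dvd p"
      unfolding m_def using prime_dvd_prod_iff[of "S - {p0}" p0 "\<lambda>p. p"] pr(1)[OF p0] fin by auto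
    then show False
      using pr(1) p0 by (metis DiffD1 DiffD2 primes_dvd_imp_eq singletonI)
  qed
  ultimately show ?thesis
    using val[OF p0] by (intro exI[of _ "g ^ m"]) simp
qed

end

text \<open>A geometric sum over all \<open>t < p\<close>, less the term \<open>1\<close> at
  \<open>t = 0\<close>, because only characters of exact order \<open>p\<close> are
  averaged.\<close>

lemma mean_unity_roots:
  assumes p: "prime p"
  shows "(\<Sum>t\<in>{1..<p}. unity_root p (t * i)) = (if p dvd i then of_nat p else 0) - 1"
proof -
  have p0: "p > 0" using p prime_gt_0_nat by blast
  define z where "z = unity_root p i"
  have "(\<Sum>t<p. unity_root p (t * i)) = (\<Sum>t<p. z ^ t)"
    by (simp add: z_def mult.commute[of _ i] unity_root_mult)
  also have "\<dots> = (if p dvd i then of_nat p else 0)"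
  proof (cases "p dvd i")
    case True
    then have "z = 1" using p0 by (simp add: z_def unity_root_eq_1_iff)
    then show ?thesis using True by simp
  next
    case False
    then have "z \<noteq> 1" using p0 by (simp add: z_def unity_root_eq_1_iff)
    moreover have "z ^ p = 1"
      using p0 by (simp add: z_def unity_root_eq_1_iff flip: unity_root_mult)
    ultimately show ?thesis using False by (simp add: geometric_sum)
  qed
  also have "{..<p} = insert 0 {1..<p}"
    using p0 by auto
  finally show ?thesis
    by (simp add: algebra_simps)
qed

section \<open>Monic irreducible factors\<close>

definition monic_irreducible_factors :: "'a::field poly \<Rightarrow> 'a poly set" where
  "monic_irreducible_factors T = {P. lead_coeff P = 1 \<and> irreducible P \<and> P dvd T}"

lemma is_unit_poly_iff_degree:
  fixes p :: "'a::field poly"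
  shows "p \<noteq> 0 \<Longrightarrow> p dvd 1 \<longleftrightarrow> degree p = 0"
  using is_unit_iff_degree by blast

lemma irreducible_poly_degree_pos:
  fixes P :: "'a::field poly"
  shows "irreducible P \<Longrightarrow> degree P > 0"
  using is_unit_poly_iff_degree[of P] by (auto simp: irreducible_def)

text \<open>A nonconstant divisor of least degree cannot split further; scaling makes it
  monic.\<close>

lemma exists_monic_irreducible_factor:
  fixes h :: "'a::field poly"
  assumes h: "degree h > 0"
  shows "\<exists>P. lead_coeff P = 1 \<and> irreducible P \<and> P dvd h"
proof -
  obtain P where P: "degree P > 0" "P dvd h"
    and min: "\<And>Q. degree Q > 0 \<Longrightarrow> Q dvd h \<Longrightarrow> degree P \<le> degree Q"
    using ex_has_least_nat[of "\<lambda>P. degree P > 0 \<and> P dvd h" h degree] h by auto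
  have "h \<noteq> 0" "P \<noteq> 0" using h P by auto
  define Q where "Q = smult (inverse (lead_coeff P)) P"
  have Q: "lead_coeff Q = 1" "degree Q = degree P" "Q dvd h"
    using P \<open>P \<noteq> 0\<close> by (auto simp: Q_def smult_dvd_iff)
  have "irreducible Q"
  proof (rule irreducibleI)
    show Q0: "Q \<noteq> 0" using Q P by auto
    show "\<not> Q dvd 1" using is_unit_poly_iff_degree[OF Q0] Q P by simp
    fix a b assume ab: "Q = a * b"
    then have nz: "a \<noteq> 0" "b \<noteq> 0" using Q0 by auto
    have deg: "degree a + degree b = degree P"
      using degree_mult_eq[OF nz] ab Q(2) by simp
    have "a dvd h" "b dvd h"
      using Q(3) ab dvd_mult_left dvd_mult_right by blast+
    then have "degree a = 0 \<or> degree b = 0"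
      using min[of a] min[of b] deg by linarith
    then show "a dvd 1 \<or> b dvd 1"
      using is_unit_poly_iff_degree nz by blast
  qed
  then show ?thesis using Q by blast
qed

text \<open>A nonzero combination of least degree divides \<open>a\<close> and \<open>b\<close> by
  division with remainder. It is constant, since otherwise it would have a monic irreducible factor
  common to both.\<close>

lemma bezout_poly:
  fixes a b :: "'a::field poly"
  assumes ab: "a \<noteq> 0 \<or> b \<noteq> 0"
    and cop: "\<And>P. lead_coeff P = 1 \<Longrightarrow> irreducible P \<Longrightarrow> P dvd a \<Longrightarrow> P dvd b \<Longrightarrow> False"
  shows "\<exists>x y. x * a + y * b = 1"
proof -
  let ?I = "\<lambda>d. d \<noteq> 0 \<and> (\<exists>x y. d = x * a + y * b)"
  have "a = 1 * a + 0 * b" "b = 0 * a + 1 * b"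
    by simp_all
  then have "\<exists>d. ?I d"
    using ab by blast
  then obtain d0 where "?I d0" ..
  from ex_has_least_nat[of ?I, OF this, of degree]
  obtain d where d: "?I d" and min: "\<And>e. ?I e \<Longrightarrow> degree d \<le> degree e"
    by blast
  obtain x y where xy: "d = x * a + y * b" using d by auto
  have "d dvd z" if "z = u * a + v * b" for z u v
  proof -
    have "z mod d = z - (z div d) * d"
      by (simp add: minus_div_mult_eq_mod)
    also have "\<dots> = (u - (z div d) * x) * a + (v - (z div d) * y) * b"
      by (subst (2) xy) (simp add: that algebra_simps)
    finally have "?I (z mod d) \<or> z mod d = 0" by blast
    then have "z mod d = 0"
      using min[of "z mod d"] degree_mod_less[of d z] d not_less by blast
    then show ?thesis
      by (simp add: dvd_eq_mod_eq_0)
  qed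
  from this[of a 1 0] this[of b 0 1] have "d dvd a" "d dvd b" by simp_all
  then have "degree d = 0"
    using exists_monic_irreducible_factor[of d] cop dvd_trans by blast
  then obtain c where c: "d = [:c:]" "c \<noteq> 0"
    using d by (metis degree_eq_zeroE pCons_0_0)
  have "smult (inverse c) x * a + smult (inverse c) y * b = smult (inverse c) d"
    by (simp add: xy smult_add_right)
  also have "\<dots> = 1" using c by simp
  finally show ?thesis by blast
qed

lemma monic_irreducible_dvd_imp_eq:
  fixes P Q :: "'a::field poly"
  assumes "lead_coeff P = 1" "lead_coeff Q = 1" "irreducible P" "irreducible Q" "P dvd Q"
  shows "P = Q"
proof -
  obtain c where c: "Q = P * c" using assms(5) by auto
  then have "c dvd 1"
    using assms(3,4) irreducibleD irreducible_not_unit by metis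
  then obtain k where k: "c = [:k:]"
    using is_unit_polyE by metis
  have "lead_coeff Q = lead_coeff P * k"
    unfolding c k lead_coeff_mult by simp
  then have "k = 1"
    using assms(1,2) by simp
  then show ?thesis using c k by simp
qed

lemma irreducible_poly_dvd_prod:
  fixes P :: "'a::field poly"
  assumes "finite J" "irreducible P" "P dvd (\<Prod>Q\<in>J. f Q)"
  shows "\<exists>Q\<in>J. P dvd f Q"
  using assms
  by (induction J rule: finite_induct)
    (auto simp: prime_elem_dvd_mult_iff[OF field_poly_irreducible_imp_prime] dest: irreducible_not_unit)

lemma irreducible_dvd_prod_monic_iff:
  fixes P :: "'a::field poly"
  assumes J: "finite J" "\<And>Q. Q \<in> J \<Longrightarrow> lead_coeff Q = 1 \<and> irreducible Q"
    and P: "lead_coeff P = 1" "irreducible P"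
  shows "P dvd \<Prod>J \<longleftrightarrow> P \<in> J"
proof
  assume "P dvd \<Prod>J"
  then obtain Q where "Q \<in> J" "P dvd Q"
    using irreducible_poly_dvd_prod[OF J(1) P(2), of "\<lambda>Q. Q"] by auto
  then show "P \<in> J"
    using monic_irreducible_dvd_imp_eq[of P Q] J P by auto
qed (use J(1) dvd_prodI[of J P "\<lambda>Q. Q"] in auto)

text \<open>A monic irreducible outside \<open>J\<close> does not divide \<open>\<Prod>J\<close>, so
  in the induction it must divide the cofactor.\<close>

lemma prod_monic_irreducibles_dvd_iff:
  fixes g :: "'a::field poly"
  assumes "finite J" "\<And>Q. Q \<in> J \<Longrightarrow> lead_coeff Q = 1 \<and> irreducible Q"
  shows "\<Prod>J dvd g \<longleftrightarrow> (\<forall>P\<in>J. P dvd g)"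
proof
  assume "\<Prod>J dvd g"
  then show "\<forall>P\<in>J. P dvd g"
    using assms(1) dvd_prodI[of J _ "\<lambda>Q. Q"] dvd_trans by blast
next
  assume "\<forall>P\<in>J. P dvd g"
  with assms show "\<Prod>J dvd g"
  proof (induction J rule: finite_induct)
    case (insert P J)
    then obtain h where h: "g = \<Prod>J * h" by auto
    have "\<not> P dvd \<Prod>J"
      using irreducible_dvd_prod_monic_iff[of J P] insert by auto
    then have "P dvd h"
      using insert.prems prime_elem_dvd_mult_iff[OF field_poly_irreducible_imp_prime, of P "\<Prod>J" h] h by auto
    then show ?case
      using insert.hyps by (simp add: h mult_dvd_mono mult.commute)
  qed simp
qed

section \<open>Residues modulo a polynomial and the product formula for their units\<close>

text \<open>Coefficients are bounded rather than the degree, so that \<open>0\<close> belongs even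
  for \<open>m = 0\<close>. It represents the residues modulo a polynomial of degree
  \<open>m\<close>.\<close>

definition polys_below :: "nat \<Rightarrow> 'a::zero poly set" where
  "polys_below m = {g. \<forall>i\<ge>m. coeff g i = 0}"

lemma polys_below_iff: "g \<in> polys_below m \<longleftrightarrow> g = 0 \<or> degree g < m"
proof
  assume g: "g \<in> polys_below m"
  show "g = 0 \<or> degree g < m"
  proof (cases "degree g < m")
    case False
    then have "lead_coeff g = 0"
      using g by (simp add: polys_below_def)
    then show ?thesis by simp
  qed simp
qed (auto simp: polys_below_def coeff_eq_0)

lemma polys_below_Suc: "polys_below (Suc m) = (\<lambda>(a, g). pCons a g) ` (UNIV \<times> polys_below m)"
proof (intro equalityI subsetI)
  fix g :: "'a poly" assume g: "g \<in> polys_below (Suc m)"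
  obtain a h where "g = pCons a h" by (rule pCons_cases)
  moreover have "h \<in> polys_below m"
    unfolding polys_below_def
  proof (rule CollectI, intro allI impI)
    fix i assume "m \<le> i"
    then have "coeff g (Suc i) = 0"
      using g by (simp add: polys_below_def)
    then show "coeff h i = 0"
      using \<open>g = pCons a h\<close> by simp
  qed
  ultimately show "g \<in> (\<lambda>(a, g). pCons a g) ` (UNIV \<times> polys_below m)" by auto
qed (auto simp: polys_below_def coeff_pCons split: nat.splits)

lemma finite_polys_below: "finite (polys_below m :: 'a::{zero,finite} poly set)"
  by (induction m) (auto simp: polys_below_Suc polys_below_iff intro: finite_subset[of _ "{0}"])

lemma card_polys_below: "card (polys_below m :: 'a::{zero,finite} poly set) = card (UNIV::'a set) ^ m"
proof (induction m)
  case 0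
  have "(polys_below 0 :: 'a poly set) = {0}" by (auto simp: polys_below_iff)
  then show ?case by simp
next
  case (Suc m)
  have "inj_on (\<lambda>(a, g). pCons a g) (UNIV \<times> polys_below m :: ('a \<times> 'a poly) set)"
    by (auto simp: inj_on_def)
  then show ?case
    using Suc by (simp add: polys_below_Suc card_image card_cartesian_product)
qed

lemma card_multiples_polys_below:
  fixes D :: "'a::{field,finite} poly"
  assumes D: "D \<noteq> 0" "degree D \<le> n"
  shows "card {g \<in> polys_below n. D dvd g} = card (UNIV::'a set) ^ (n - degree D)"
proof -
  have "{g \<in> polys_below n. D dvd g} = (\<lambda>h. D * h) ` polys_below (n - degree D)"
  proof (intro equalityI subsetI)
    fix g assume "g \<in> {g \<in> polys_below n. D dvd g}"
    then have g: "g = 0 \<or> degree g < n" and "D dvd g"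
      by (simp_all add: polys_below_iff)
    then obtain h where h: "g = D * h"
      by (elim dvdE)
    have "h \<in> polys_below (n - degree D)"
      using g D by (cases "h = 0") (auto simp: polys_below_iff h degree_mult_eq)
    then show "g \<in> (\<lambda>h. D * h) ` polys_below (n - degree D)"
      using h by auto
  next
    fix g assume "g \<in> (\<lambda>h. D * h) ` polys_below (n - degree D)"
    then obtain h where h: "g = D * h" "h = 0 \<or> degree h < n - degree D"
      unfolding polys_below_iff[symmetric] by blast
    then show "g \<in> {g \<in> polys_below n. D dvd g}"
      using D by (cases "h = 0") (auto simp: polys_below_iff degree_mult_eq)
  qed
  moreover have "inj_on (\<lambda>h. D * h) (polys_below (n - degree D))"
    using D by (auto simp: inj_on_def)
  ultimately show ?thesis
    by (simp add: card_image card_polys_below)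
qed

lemma finite_monic_irreducible_factors:
  fixes T :: "'a::{field,finite} poly"
  assumes "T \<noteq> 0"
  shows "finite (monic_irreducible_factors T)"
proof (rule finite_subset[OF _ finite_polys_below])
  show "monic_irreducible_factors T \<subseteq> polys_below (Suc (degree T))"
    using assms by (auto simp: monic_irreducible_factors_def polys_below_iff less_Suc_eq_le dvd_imp_degree_le)
qed

text \<open>Bezout supplies the inverse; conversely, an irreducible factor of \<open>T\<close>
  dividing a unit \<open>g\<close> would divide \<open>1\<close>.\<close>

lemma Phi_poly_eq_card:
  fixes T :: "'a::{field,finite} poly"
  assumes T: "degree T > 0"
  shows "Phi_poly T = card {g \<in> polys_below (degree T). \<forall>P\<in>monic_irreducible_factors T. \<not> P dvd g}"
  unfolding Phi_poly_def
proof (intro arg_cong[of _ _ card] Collect_cong conj_cong)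
  have T0: "T \<noteq> 0" using T by auto
  fix g :: "'a poly"
  show "g mod T = g \<longleftrightarrow> g \<in> polys_below (degree T)"
    unfolding polys_below_iff using T0 degree_mod_less[of T g] mod_poly_less[of g T] mod_0 by metis
  show "(\<exists>h. (g * h) mod T = 1 mod T) \<longleftrightarrow> (\<forall>P\<in>monic_irreducible_factors T. \<not> P dvd g)"
  proof
    assume "\<exists>h. (g * h) mod T = 1 mod T"
    then obtain h where "T dvd g * h - 1"
      by (auto simp: mod_eq_dvd_iff)
    show "\<forall>P\<in>monic_irreducible_factors T. \<not> P dvd g"
    proof (intro ballI notI)
      fix P assume P: "P \<in> monic_irreducible_factors T" "P dvd g"
      then have "P dvd g * h - 1" "P dvd g * h"
        using \<open>T dvd g * h - 1\<close> by (auto simp: monic_irreducible_factors_def intro: dvd_trans)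
      then have "P dvd 1"
        using dvd_diff[of P "g * h" "g * h - 1"] by simp
      then show False
        using P by (simp add: monic_irreducible_factors_def irreducible_not_unit)
    qed
  next
    assume "\<forall>P\<in>monic_irreducible_factors T. \<not> P dvd g"
    then obtain x y where "x * g + y * T = 1"
      using bezout_poly[of g T] T0 by (auto simp: monic_irreducible_factors_def)
    then have "(g * x) mod T = 1 mod T"
      by (metis mod_mult_self1 mult.commute)
    then show "\<exists>h. (g * h) mod T = 1 mod T" by blast
  qed
qed

text \<open>Inclusion-exclusion over sets \<open>J\<close> of irreducible factors: the multiples of
  \<open>\<Prod>J\<close> among the residues have density
  \<open>1 / real q ^ degree (\<Prod>J)\<close>, which is multiplicative over
  \<open>J\<close>.\<close>

lemma Theta_poly_eq_prod:
  fixes T :: "'a::{field,finite} poly"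
  assumes T: "degree T > 0" and q: "q = card (UNIV::'a set)"
  shows "Theta_poly q T = (\<Prod>P\<in>monic_irreducible_factors T. 1 - 1 / real q ^ degree P)"
proof -
  let ?F = "monic_irreducible_factors T" and ?n = "degree T"
  have T0: "T \<noteq> 0" using T by auto
  have fin: "finite ?F" by (rule finite_monic_irreducible_factors[OF T0])
  have q0: "real q > 0" using q by (simp add: card_gt_0_iff)
  have "real (Phi_poly T) = (\<Sum>g\<in>polys_below ?n. \<Prod>P\<in>?F. 1 - (if P dvd g then 1 else 0))"
  proof -
    have "(\<Prod>P\<in>?F. 1 - (if P dvd g then 1 else 0)) = (if \<forall>P\<in>?F. \<not> P dvd g then 1 else (0::real))" for g
      using fin by (auto intro!: prod.neutral)
    then show ?thesis
      by (simp add: Phi_poly_eq_card[OF T] sum.If_cases finite_polys_below Int_def)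
  qed
  also have "\<dots> = (\<Sum>J\<in>Pow ?F. (-1) ^ card J * (\<Sum>g\<in>polys_below ?n. \<Prod>P\<in>J. if P dvd g then 1 else 0))"
    unfolding prod_one_minus_expand[OF fin] sum_distrib_left by (rule sum.swap)
  also have "\<dots> = (\<Sum>J\<in>Pow ?F. (-1) ^ card J * (real q ^ ?n * (\<Prod>P\<in>J. 1 / real q ^ degree P)))"
  proof (intro sum.cong refl arg_cong2[of _ _ _ _ "(*)"])
    fix J assume J: "J \<in> Pow ?F"
    then have finJ: "finite J" using fin finite_subset by blast
    have mon: "lead_coeff Q = 1 \<and> irreducible Q" if "Q \<in> J" for Q
      using J that by (auto simp: monic_irreducible_factors_def)
    have "\<Prod>J dvd T"
      using J by (subst prod_monic_irreducibles_dvd_iff[OF finJ mon]) (auto simp: monic_irreducible_factors_def)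
    then have J0: "\<Prod>J \<noteq> 0" "degree (\<Prod>J) \<le> ?n"
      using T0 dvd_imp_degree_le by auto
    have deg: "degree (\<Prod>J) = (\<Sum>P\<in>J. degree P)"
      by (rule degree_prod_sum_eq) (use mon in force)
    have "(\<Sum>g\<in>polys_below ?n. \<Prod>P\<in>J. if P dvd g then 1 else (0::real))
        = (\<Sum>g\<in>polys_below ?n. if \<Prod>J dvd g then 1 else 0)"
    proof (rule sum.cong)
      fix g
      show "(\<Prod>P\<in>J. if P dvd g then 1 else (0::real)) = (if \<Prod>J dvd g then 1 else 0)"
        using finJ by (subst prod_monic_irreducibles_dvd_iff[OF finJ mon]) (auto intro!: prod.neutral)
    qed simp
    also have "\<dots> = real (card {g \<in> polys_below ?n. \<Prod>J dvd g})"
      by (simp add: sum.If_cases finite_polys_below Int_def)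
    also have "\<dots> = real q ^ (?n - degree (\<Prod>J))"
      by (simp add: card_multiples_polys_below[OF J0] q)
    also have "\<dots> = real q ^ ?n * (1 / real q ^ degree (\<Prod>J))"
      using q0 J0 by (simp add: power_diff)
    also have "1 / real q ^ degree (\<Prod>J) = (\<Prod>P\<in>J. 1 / real q ^ degree P)"
      by (simp add: deg power_sum prod_dividef)
    finally show "(\<Sum>g\<in>polys_below ?n. \<Prod>P\<in>J. if P dvd g then 1 else (0::real))
        = real q ^ ?n * (\<Prod>P\<in>J. 1 / real q ^ degree P)" .
  qed
  also have "\<dots> = real q ^ ?n * (\<Prod>P\<in>?F. 1 - 1 / real q ^ degree P)"
    unfolding prod_one_minus_expand[OF fin] by (simp add: sum_distrib_left mult_ac)
  finally show ?thesis
    using q0 by (simp add: Theta_poly_def)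
qed

section \<open>Squarefree divisors\<close>

text \<open>Different sets of monic irreducible factors have different products, each a squarefree
  monic divisor. A lower bound suffices, as \<open>W_poly\<close> only enlarges the error
  term.\<close>

lemma W_poly_ge:
  fixes T :: "'a::{field,finite} poly"
  assumes T: "T \<noteq> 0"
  shows "2 ^ card (monic_irreducible_factors T) \<le> W_poly T"
proof -
  let ?F = "monic_irreducible_factors T"
  let ?D = "{g. lead_coeff g = 1 \<and> g dvd T \<and> squarefree g}"
  have fin: "finite ?F" by (rule finite_monic_irreducible_factors[OF T])
  have finJ: "finite J" if "J \<in> Pow ?F" for J
    using that fin finite_subset by blast
  have mon: "lead_coeff Q = 1 \<and> irreducible Q" if "J \<in> Pow ?F" "Q \<in> J" for J Q
    using that by (auto simp: monic_irreducible_factors_def)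
  have iff: "P dvd \<Prod>J \<longleftrightarrow> P \<in> J" if "J \<in> Pow ?F" "lead_coeff P = 1" "irreducible P" for P J
    using irreducible_dvd_prod_monic_iff[OF finJ[OF that(1)] mon[OF that(1)] that(2,3)] .
  have "inj_on (\<lambda>J. \<Prod>J) (Pow ?F)"
  proof (rule inj_onI)
    fix J J' assume J: "J \<in> Pow ?F" "J' \<in> Pow ?F" "\<Prod>J = \<Prod>J'"
    show "J = J'"
    proof (rule Set.set_eqI)
      fix P
      show "P \<in> J \<longleftrightarrow> P \<in> J'"
        using iff[OF J(1), of P] iff[OF J(2), of P] mon[OF J(1), of P] mon[OF J(2), of P] J(3) by metis
    qed
  qed
  moreover have "(\<lambda>J. \<Prod>J) ` Pow ?F \<subseteq> ?D"
  proof (rule image_subsetI, rule CollectI, intro conjI)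
    fix J assume J: "J \<in> Pow ?F"
    show "lead_coeff (\<Prod>J) = 1"
      using mon[OF J] by (simp add: lead_coeff_prod)
    show dvd: "\<Prod>J dvd T"
      using J by (subst prod_monic_irreducibles_dvd_iff[OF finJ[OF J] mon[OF J]]) (auto simp: monic_irreducible_factors_def)
    show "squarefree (\<Prod>J)"
    proof (rule squarefreeI)
      fix x assume x: "x ^ 2 dvd \<Prod>J"
      have x0: "x \<noteq> 0" using x dvd T by auto
      show "x dvd 1"
      proof (rule ccontr)
        assume "\<not> x dvd 1"
        then have "degree x > 0" using is_unit_poly_iff_degree[OF x0] by simp
        then obtain P where P: "lead_coeff P = 1" "irreducible P" "P dvd x"
          using exists_monic_irreducible_factor by blast
        \<comment> \<open>Cancelling one \<open>P\<close> would leave \<open>P\<close> dividing the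
          product of the other factors, to which it does not belong.\<close>
        have P2: "P * P dvd \<Prod>J"
          using dvd_trans[OF mult_dvd_mono[OF P(3,3)] x[unfolded power2_eq_square]] .
        then have "P \<in> J"
          unfolding iff[OF J P(1,2), symmetric] by (rule dvd_mult_left)
        then have "P * P dvd P * \<Prod>(J - {P})"
          using P2 finJ[OF J] by (simp add: prod.remove)
        then have "P dvd \<Prod>(J - {P})"
          using P(1) by auto
        moreover have "J - {P} \<in> Pow ?F" using J by blast
        ultimately show False
          using iff[of "J - {P}" P] P by simp
      qed
    qed
  qed
  moreover have "finite ?D"
    using T by (intro finite_subset[OF _ finite_polys_below[of "Suc (degree T)"]])
      (auto simp: polys_below_iff less_Suc_eq_le dvd_imp_degree_le)
  ultimately have "card (Pow ?F) \<le> card ?D"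
    by (rule card_inj_on_le)
  then show ?thesis
    using fin by (simp add: card_Pow W_poly_def)
qed

text \<open>The set \<open>J\<close> is recovered from \<open>\<Prod>J\<close> as its multiset of
  prime factors, all of multiplicity \<open>1\<close>.\<close>

lemma W_nat_ge:
  assumes m: "m > 0"
  shows "2 ^ card (prime_factors m) \<le> W_nat m"
proof -
  let ?F = "prime_factors m"
  have pf: "prime_factorization (\<Prod>J) = mset_set J" if "J \<in> Pow ?F" for J
  proof -
    have fin: "finite J" using that finite_subset by blast
    have "prime_factorization (prod_mset (mset_set J)) = mset_set J"
      by (rule prime_factorization_prod_mset_primes) (use that fin in auto)
    then show ?thesis
      by (simp add: prod_unfold_prod_mset)
  qed
  have "inj_on (\<lambda>J. \<Prod>J) (Pow ?F)"
  proof (rule inj_onI)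
    fix J J' assume J: "J \<in> Pow ?F" "J' \<in> Pow ?F" "\<Prod>J = \<Prod>J'"
    then have "mset_set J = mset_set J'" using pf by metis
    moreover have "finite J" "finite J'" using J finite_subset by blast+
    ultimately show "J = J'" by simp
  qed
  moreover have "(\<lambda>J. \<Prod>J) ` Pow ?F \<subseteq> {d. d dvd m \<and> squarefree d}"
  proof (rule image_subsetI, rule CollectI, intro conjI)
    fix J assume J: "J \<in> Pow ?F"
    have fin: "finite J" using J finite_subset by blast
    have nz: "\<Prod>J \<noteq> 0" using J fin by (auto simp: in_prime_factors_iff)
    have "mset_set J \<subseteq># prime_factorization m"
      using J fin by (auto simp: subseteq_mset_def count_mset_set' Suc_le_eq)
    then show "\<Prod>J dvd m"
      using nz m by (simp add: prime_factorization_subset_iff_dvd[symmetric] pf[OF J])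
    show "squarefree (\<Prod>J)"
    proof (subst squarefree_factorial_semiring'[OF nz], rule ballI)
      fix p assume p: "p \<in> prime_factors (\<Prod>J)"
      then have "multiplicity p (\<Prod>J) = count (prime_factorization (\<Prod>J)) p"
        by (simp add: count_prime_factorization_prime in_prime_factors_iff)
      then show "multiplicity p (\<Prod>J) = 1"
        using p fin by (simp add: pf[OF J])
    qed
  qed
  moreover have "finite {d. d dvd m \<and> squarefree d}"
    using m by simp
  ultimately have "card (Pow ?F) \<le> card {d. d dvd m \<and> squarefree d}"
    by (rule card_inj_on_le)
  then show ?thesis
    by (simp add: card_Pow W_nat_def)
qed

section \<open>The action of polynomials by the Frobenius endomorphism\<close>

locale field_extension =
  fixes emb :: "'a::{field,finite} \<Rightarrow> 'b::{field,finite}" and q n :: nat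
  assumes q: "q = card (UNIV::'a set)"
    and n: "n > 0"
    and card_ext: "card (UNIV::'b set) = q ^ n"
    and emb: "ring_emb emb"
begin

abbreviation act :: "'a poly \<Rightarrow> 'b \<Rightarrow> 'b" where
  "act \<equiv> q_assoc emb q"

abbreviation xn1 :: "'a poly" where
  "xn1 \<equiv> monom 1 n - 1"

lemma emb_1: "emb 1 = 1"
  and emb_add: "emb (x + y) = emb x + emb y"
  and emb_mult: "emb (x * y) = emb x * emb y"
  using emb by (auto simp: ring_emb_def)

lemma emb_0: "emb 0 = 0"
  using emb_add[of 0 0] by (metis add.right_neutral add_left_cancel)

lemma emb_diff: "emb (x - y) = emb x - emb y"
  using emb_add[of "x - y" y] by simp

lemma emb_eq_0_iff: "emb c = 0 \<longleftrightarrow> c = 0"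
proof
  assume c: "emb c = 0"
  show "c = 0"
  proof (rule ccontr)
    assume "c \<noteq> 0"
    then have "emb c * emb (inverse c) = 1"
      by (simp add: emb_1 flip: emb_mult)
    then show False using c by simp
  qed
qed (simp add: emb_0)

lemma emb_power: "emb (c ^ i) = emb c ^ i"
  by (induction i) (auto simp: emb_1 emb_mult)

lemma emb_power_q: "emb c ^ q = emb c"
  by (simp add: q finite_field_power_card flip: emb_power)

lemma q_gt_1: "q > 1"
proof -
  have "card {0, 1::'a} \<le> q"
    unfolding q by (rule card_mono) auto
  then show ?thesis by simp
qed

text \<open>\<open>q\<close> divides \<open>q ^ n\<close>, a power of the prime
  \<open>CHAR('b)\<close>. This makes \<open>x \<mapsto> x ^ q\<close> additive on the
  extension.\<close>

lemma q_eq_CHAR_power: "\<exists>j. q = CHAR('b) ^ j"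
proof -
  obtain m where "card (UNIV::'b set) = CHAR('b) ^ m"
    using card_finite_field_eq_CHAR_power by blast
  then have "q dvd CHAR('b) ^ m"
    using card_ext n by (metis dvd_power)
  then show ?thesis
    using divides_primepow_nat[OF prime_CHAR_finite_field[where ?'a = 'b]] by blast
qed

lemma frobenius_add: "(x + y :: 'b) ^ (q ^ i) = x ^ (q ^ i) + y ^ (q ^ i)"
proof -
  obtain j where "q = CHAR('b) ^ j"
    using q_eq_CHAR_power by blast
  then have "q ^ i = CHAR('b) ^ (j * i)"
    by (simp add: power_mult)
  then show ?thesis
    by (rule freshmans_dream'[OF prime_CHAR_finite_field])
qed

lemma frobenius_sum: "(sum f A :: 'b) ^ q = (\<Sum>i\<in>A. f i ^ q)"
  using q_eq_CHAR_power freshmans_dream_sum'[OF prime_CHAR_finite_field[where ?'a = 'b]] by blast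

section \<open>The extension field as a module over polynomials\<close>

text \<open>Frees the sum from the degree, so that different polynomials can share one index
  range.\<close>

lemma act_eq_sum:
  assumes "g \<in> polys_below m"
  shows "act g x = (\<Sum>i<m. emb (coeff g i) * x ^ (q ^ i))"
  unfolding q_assoc_def
proof (rule sum.mono_neutral_cong)
  show "\<And>i. i \<in> {..<m} - {..degree g} \<Longrightarrow> emb (coeff g i) * x ^ q ^ i = 0"
    by (auto simp: coeff_eq_0 emb_0)
  show "\<And>i. i \<in> {..degree g} - {..<m} \<Longrightarrow> emb (coeff g i) * x ^ q ^ i = 0"
    using assms by (auto simp: polys_below_def emb_0)
qed auto

lemma polys_below_mono: "g \<in> polys_below m \<Longrightarrow> m \<le> m' \<Longrightarrow> g \<in> polys_below m'"
  by (auto simp: polys_below_def)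

lemma act_0: "act 0 x = 0"
  by (simp add: q_assoc_def emb_0)

lemma act_1: "act 1 x = x"
  by (simp add: q_assoc_def emb_1)

lemma act_add: "act (g + h) x = act g x + act h x"
proof -
  let ?m = "Suc (max (degree g) (degree h))"
  have "g \<in> polys_below ?m" "h \<in> polys_below ?m" "g + h \<in> polys_below ?m"
    by (auto simp: polys_below_def coeff_eq_0)
  then show ?thesis
    by (simp add: act_eq_sum emb_add algebra_simps flip: sum.distrib)
qed

lemma act_smult: "act (Polynomial.smult c g) x = emb c * act g x"
proof -
  have "g \<in> polys_below (Suc (degree g))" "Polynomial.smult c g \<in> polys_below (Suc (degree g))"
    by (auto simp: polys_below_def coeff_eq_0)
  then show ?thesis
    by (simp add: act_eq_sum emb_mult sum_distrib_left mult.assoc del: sum.lessThan_Suc)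
qed

text \<open>The variable acts as \<open>y \<mapsto> y ^ q\<close>: this map is additive and fixes
  the embedded coefficients.\<close>

lemma act_pCons: "act (pCons c g) x = emb c * x + (act g x) ^ q"
proof -
  have *: "g \<in> polys_below (Suc (degree g))" "pCons c g \<in> polys_below (Suc (Suc (degree g)))"
    by (auto simp: polys_below_def coeff_eq_0 coeff_pCons split: nat.splits)
  have "act (pCons c g) x = emb c * x + (\<Sum>i<Suc (degree g). emb (coeff g i) * x ^ (q ^ Suc i))"
    unfolding act_eq_sum[OF *(2)] sum.lessThan_Suc_shift by simp
  also have "(\<Sum>i<Suc (degree g). emb (coeff g i) * x ^ (q ^ Suc i)) = (act g x) ^ q"
    unfolding act_eq_sum[OF *(1)] frobenius_sum
    by (intro sum.cong refl) (simp add: power_mult_distrib emb_power_q mult.commute flip: power_mult)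
  finally show ?thesis .
qed

text \<open>Composition of \<open>q\<close>-associates is multiplication of polynomials; the
  induction on \<open>g\<close> splits off one Frobenius at a time.\<close>

lemma act_mult: "act (g * h) x = act g (act h x)"
proof (induction g)
  case 0
  then show ?case by (simp add: act_0)
next
  case (pCons c g)
  then show ?case
    by (simp add: mult_pCons_left act_add act_smult act_pCons emb_0)
qed

lemma additive_map_act: "additive_map (act g)"
  unfolding additive_map_def q_assoc_def
  by (simp add: frobenius_add distrib_left sum.distrib)

lemma act_monom: "act (monom 1 n) x = x"
proof -
  have "act (monom 1 n) x = (\<Sum>i\<le>n. if i = n then x ^ (q ^ n) else 0)"
    unfolding q_assoc_def degree_monom_eq[OF one_neq_zero]
    by (intro sum.cong refl) (simp add: emb_0 emb_1)
  then show ?thesis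
    by (simp add: finite_field_power_card flip: card_ext)
qed

lemma act_xn1: "act xn1 x = 0"
  using act_add[of xn1 1 x] by (simp add: act_monom act_1)

lemma degree_xn1: "degree xn1 = n"
proof -
  have "degree (monom (1::'a) n + - 1) = degree (monom (1::'a) n)"
    by (rule degree_add_eq_left) (use n in \<open>simp add: degree_monom_eq\<close>)
  then show ?thesis by (simp add: degree_monom_eq)
qed

lemma xn1_nonzero: "xn1 \<noteq> 0"
  using degree_xn1 n by auto

section \<open>Kernels of the action\<close>

text \<open>The kernel is the root set of a nonzero polynomial over the extension, of degree at most
  \<open>q ^ degree g\<close>.\<close>

lemma card_kernel_act_le:
  assumes "g \<noteq> 0"
  shows "card {x. act g x = 0} \<le> q ^ degree g"
proof -
  define p where "p = (\<Sum>i\<le>degree g. monom (emb (coeff g i)) (q ^ i))"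
  have "poly p x = act g x" for x
    by (simp add: p_def q_assoc_def poly_sum poly_monom)
  moreover have "coeff p (q ^ degree g) = emb (lead_coeff g)"
    using q_gt_1 by (simp add: p_def coeff_sum)
  then have "p \<noteq> 0"
    using assms by (auto simp: emb_eq_0_iff)
  moreover have "degree p \<le> q ^ degree g"
    unfolding p_def
    by (rule degree_sum_le) (use q_gt_1 in \<open>auto intro: order.trans[OF degree_monom_le]\<close>)
  ultimately show ?thesis
    using card_poly_roots_bound[of p] by simp
qed

text \<open>For the cofactor \<open>h\<close> of \<open>g\<close>, the image of \<open>act h\<close>
  lies in the kernel of \<open>act g\<close>. The kernel of \<open>act h\<close> has at most
  \<open>q ^ degree h\<close> elements, so that image is large enough to force equality.\<close>

lemma card_kernel_act:
  assumes "g dvd xn1"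
  shows "card {x. act g x = 0} = q ^ degree g"
proof (rule antisym)
  obtain h where h: "xn1 = g * h" using assms by auto
  then have gh: "g \<noteq> 0" "h \<noteq> 0" using xn1_nonzero by auto
  then have deg: "degree g + degree h = n"
    using degree_xn1 by (simp add: h degree_mult_eq)
  show "card {x. act g x = 0} \<le> q ^ degree g"
    by (rule card_kernel_act_le[OF gh(1)])
  have "range (act h) \<subseteq> {x. act g x = 0}"
    using act_xn1 by (auto simp: h act_mult)
  then have "card (range (act h)) \<le> card {x. act g x = 0}"
    by (intro card_mono) auto
  then have "card {x. act h x = 0} * card (range (act h)) \<le> q ^ degree h * card {x. act g x = 0}"
    by (intro mult_mono card_kernel_act_le[OF gh(2)]) auto
  then have "q ^ degree h * q ^ degree g \<le> q ^ degree h * card {x. act g x = 0}"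
    unfolding card_kernel_mult_card_range[OF additive_map_act] card_ext deg[symmetric] power_add
    by (simp only: mult.commute)
  then show "q ^ degree g \<le> card {x. act g x = 0}"
    using q_gt_1 by simp
qed

section \<open>Spans of conjugates, normal and k-normal elements\<close>

lemma lin_comb_cong: "(\<And>i. i < m \<Longrightarrow> c i = c' i) \<Longrightarrow> lin_comb emb v m c = lin_comb emb v m c'"
  by (simp add: lin_comb_def)

lemma card_fspan:
  assumes "findep emb v m"
  shows "card (fspan emb v m) = q ^ m"
proof -
  \<comment> \<open>\<open>lin_comb\<close> sees only the first \<open>m\<close> coefficients;
    extensional functions give each coefficient vector one representative.\<close>
  let ?E = "{..<m} \<rightarrow>\<^sub>E (UNIV::'a set)"
  have "fspan emb v m = lin_comb emb v m ` ?E"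
    unfolding fspan_def
  proof (intro equalityI subsetI)
    fix y assume "y \<in> range (lin_comb emb v m)"
    then obtain c where "y = lin_comb emb v m c" by blast
    then have "y = lin_comb emb v m (restrict c {..<m})"
      using lin_comb_cong[of m c "restrict c {..<m}" v] by simp
    then show "y \<in> lin_comb emb v m ` ?E"
      by (intro image_eqI[of _ _ "restrict c {..<m}"]) simp_all
  qed blast
  moreover have "inj_on (lin_comb emb v m) ?E"
  proof (rule inj_onI)
    fix c c' assume c: "c \<in> ?E" "c' \<in> ?E" "lin_comb emb v m c = lin_comb emb v m c'"
    then have "lin_comb emb v m (\<lambda>i. c i - c' i) = 0"
      by (simp add: lin_comb_def emb_diff left_diff_distrib sum_subtractf)
    then have "\<forall>i<m. c i = c' i"
      using assms unfolding findep_def by fastforce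
    then show "c = c'"
      using c by (intro PiE_ext[of c "{..<m}"]) auto
  qed
  ultimately show ?thesis
    by (simp add: card_image card_PiE q)
qed

lemma lin_comb_conjs: "g \<in> polys_below m \<Longrightarrow> lin_comb emb (conjs q x) m (coeff g) = act g x"
  by (simp add: lin_comb_def conjs_def act_eq_sum)

lemma exists_poly_of_coeffs: "\<exists>g\<in>polys_below m. \<forall>i<m. coeff g i = (c i :: 'a)"
  by (rule bexI[of _ "\<Sum>i<m. monom (c i) i"]) (auto simp: polys_below_def coeff_sum)

text \<open>Coefficient vectors of length \<open>m\<close> are polynomials in
  \<open>polys_below m\<close>, and a linear combination of conjugates is the action of that
  polynomial.\<close>

lemma findep_conjs_iff:
  "findep emb (conjs q x) m \<longleftrightarrow> (\<forall>g\<in>polys_below m. act g x = 0 \<longrightarrow> g = 0)"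
proof
  assume ind: "findep emb (conjs q x) m"
  show "\<forall>g\<in>polys_below m. act g x = 0 \<longrightarrow> g = 0"
  proof (intro ballI impI poly_eqI)
    fix g i assume g: "g \<in> polys_below m" "act g x = 0"
    then have "\<forall>i<m. coeff g i = 0"
      using ind by (simp add: findep_def flip: lin_comb_conjs)
    then show "coeff g i = coeff 0 i"
      using g by (cases "i < m") (auto simp: polys_below_def)
  qed
next
  assume *: "\<forall>g\<in>polys_below m. act g x = 0 \<longrightarrow> g = 0"
  show "findep emb (conjs q x) m"
    unfolding findep_def
  proof (intro allI impI)
    fix c i assume c: "lin_comb emb (conjs q x) m c = 0" and i: "i < m"
    obtain g where g: "g \<in> polys_below m" "\<forall>i<m. coeff g i = c i"
      using exists_poly_of_coeffs by blast
    then have "act g x = 0"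
      using c lin_comb_cong[of m "coeff g" c "conjs q x"] by (simp flip: lin_comb_conjs)
    then show "c i = 0"
      using * g i by auto
  qed
qed

lemma fspan_conjs: "fspan emb (conjs q x) m = (\<lambda>g. act g x) ` polys_below m"
  unfolding fspan_def
proof (intro equalityI subsetI)
  fix y assume "y \<in> range (lin_comb emb (conjs q x) m)"
  then obtain c where c: "y = lin_comb emb (conjs q x) m c" by blast
  obtain g where g: "g \<in> polys_below m" "\<forall>i<m. coeff g i = c i"
    using exists_poly_of_coeffs by blast
  then have "y = act g x"
    using c lin_comb_cong[of m "coeff g" c "conjs q x"] by (simp flip: lin_comb_conjs)
  then show "y \<in> (\<lambda>g. act g x) ` polys_below m"
    using g by blast
next
  fix y assume "y \<in> (\<lambda>g. act g x) ` polys_below m"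
  then obtain g where "g \<in> polys_below m" "y = act g x" by blast
  then have "y = lin_comb emb (conjs q x) m (coeff g)"
    by (simp add: lin_comb_conjs)
  then show "y \<in> range (lin_comb emb (conjs q x) m)" by blast
qed

text \<open>Independence already implies spanning, since the span of \<open>n\<close> independent
  elements has \<open>q ^ n\<close> members.\<close>

lemma normal_elt_iff_annihilator:
  "normal_elt emb q n x \<longleftrightarrow> (\<forall>g\<in>polys_below n. act g x = 0 \<longrightarrow> g = 0)"
proof -
  have "fspan emb (conjs q x) n = UNIV" if "findep emb (conjs q x) n"
    using card_fspan[OF that] card_ext by (intro card_subset_eq) auto
  then show ?thesis
    by (auto simp: normal_elt_def findep_conjs_iff)
qed

text \<open>If \<open>x\<close> is not normal, a nonzero annihilator of least degree is a proper
  divisor of \<open>xn1\<close>. For an irreducible factor \<open>P\<close> of its cofactor,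
  \<open>xn1 div P\<close> is a multiple of it and annihilates \<open>x\<close> as well.\<close>

lemma normal_elt_iff:
  "normal_elt emb q n x \<longleftrightarrow> (\<forall>P\<in>monic_irreducible_factors xn1. act (xn1 div P) x \<noteq> 0)"
proof
  assume normal: "normal_elt emb q n x"
  show "\<forall>P\<in>monic_irreducible_factors xn1. act (xn1 div P) x \<noteq> 0"
  proof
    fix P assume P: "P \<in> monic_irreducible_factors xn1"
    then have PT: "P * (xn1 div P) = xn1" and "degree P > 0"
      by (auto simp: monic_irreducible_factors_def irreducible_poly_degree_pos)
    have nz: "P \<noteq> 0" "xn1 div P \<noteq> 0"
      using PT xn1_nonzero by fastforce+
    have "degree P + degree (xn1 div P) = n"
      using degree_xn1 degree_mult_eq[OF nz] PT by simp
    then have "xn1 div P \<in> polys_below n"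
      using \<open>degree P > 0\<close> by (simp add: polys_below_iff)
    then show "act (xn1 div P) x \<noteq> 0"
      using normal nz(2) unfolding normal_elt_iff_annihilator by blast
  qed
next
  assume *: "\<forall>P\<in>monic_irreducible_factors xn1. act (xn1 div P) x \<noteq> 0"
  show "normal_elt emb q n x"
    unfolding normal_elt_iff_annihilator
  proof (intro ballI impI, rule ccontr)
    fix g0 assume g0: "g0 \<in> polys_below n" "act g0 x = 0" "g0 \<noteq> 0"
    let ?A = "\<lambda>g. g \<noteq> 0 \<and> act g x = 0"
    from ex_has_least_nat[of ?A g0 degree]
    obtain g where g: "?A g" and min: "\<And>h. ?A h \<Longrightarrow> degree g \<le> degree h"
      using g0 by blast
    have "degree g < n"
      using min[of g0] g0 by (simp add: polys_below_iff)
    have "act (xn1 div g * g + xn1 mod g) x = 0"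
      by (simp add: act_xn1)
    then have "act (xn1 mod g) x = 0"
      using g additive_map_0[OF additive_map_act] unfolding act_add act_mult by simp
    then have "xn1 mod g = 0"
      using min[of "xn1 mod g"] degree_mod_less[of g xn1] g not_less by blast
    then obtain h where h: "xn1 = g * h"
      by (metis dvd_eq_mod_eq_0 dvdE)
    have "h \<noteq> 0" using h xn1_nonzero by auto
    then have "degree h > 0"
      using degree_xn1 \<open>degree g < n\<close> g by (simp add: h degree_mult_eq)
    then obtain P where P: "lead_coeff P = 1" "irreducible P" "P dvd h"
      using exists_monic_irreducible_factor by blast
    then obtain h' where h': "h = P * h'" by auto
    have P0: "P \<noteq> 0" using P(1) by auto
    have "xn1 div P = h' * g"
      using P0 by (simp add: h h' mult_ac)
    then have "act (xn1 div P) x = 0"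
      using g additive_map_0[OF additive_map_act] by (simp add: act_mult)
    moreover have "P \<in> monic_irreducible_factors xn1"
      using P h by (simp add: monic_irreducible_factors_def)
    ultimately show False using * by blast
  qed
qed

text \<open>The image \<open>act f x\<close> is annihilated by the cofactor \<open>h\<close> of
  \<open>f\<close> and by no nonzero polynomial of smaller degree. Reduction modulo \<open>h\<close>
  then shows that its first \<open>degree h\<close> conjugates form a basis of the span.\<close>

lemma k_normal_act:
  assumes f: "f dvd xn1" and x: "normal_elt emb q n x"
  shows "k_normal emb q n (degree f) (act f x)"
proof -
  let ?y = "act f x" and ?d = "n - degree f"
  obtain h where h: "xn1 = f * h" using f by auto
  then have fh: "f \<noteq> 0" "h \<noteq> 0" using xn1_nonzero by auto
  then have deg: "degree f + degree h = n"
    using degree_xn1 by (simp add: h degree_mult_eq)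
  have ind: "findep emb (conjs q ?y) ?d"
    unfolding findep_conjs_iff
  proof (intro ballI impI)
    fix g assume g: "g \<in> polys_below ?d" "act g ?y = 0"
    have "g * f \<in> polys_below n"
      using g(1) fh by (cases "g = 0") (auto simp: polys_below_iff degree_mult_eq)
    moreover have "act (g * f) x = 0"
      using g by (simp add: act_mult)
    ultimately have "g * f = 0"
      using x unfolding normal_elt_iff_annihilator by blast
    then show "g = 0" using fh by simp
  qed
  have span: "fspan emb (conjs q ?y) ?d = fspan emb (conjs q ?y) n"
    unfolding fspan_conjs
  proof (intro equalityI subsetI)
    fix z assume "z \<in> (\<lambda>g. act g ?y) ` polys_below ?d"
    then show "z \<in> (\<lambda>g. act g ?y) ` polys_below n"
      using polys_below_mono[of _ ?d n] by auto
  next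
    fix z assume "z \<in> (\<lambda>g. act g ?y) ` polys_below n"
    then obtain g where g: "z = act g ?y" by blast
    have "act h ?y = 0"
      using act_xn1[of x] by (simp add: h mult.commute[of f h] act_mult)
    then have "z = act (g mod h) ?y"
      using act_add[of "g div h * h" "g mod h" ?y] additive_map_0[OF additive_map_act]
      by (simp add: g act_mult)
    moreover have "g mod h \<in> polys_below ?d"
      using degree_mod_less[OF fh(2), of g] deg by (auto simp: polys_below_iff)
    ultimately show "z \<in> (\<lambda>g. act g ?y) ` polys_below ?d" by blast
  qed
  show ?thesis
    unfolding k_normal_def fdim_def
  proof (rule the_equality)
    show "\<exists>v. findep emb v ?d \<and> fspan emb v ?d = fspan emb (conjs q ?y) n"
      using ind span by blast
    \<comment> \<open>Uniqueness for the definite description in \<open>fdim\<close>: the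
      cardinality \<open>q ^ d\<close> of the span determines \<open>d\<close>.\<close>
    fix d assume "\<exists>v. findep emb v d \<and> fspan emb v d = fspan emb (conjs q ?y) n"
    then have "q ^ d = q ^ ?d"
      using card_fspan ind span by metis
    then show "d = ?d" using q_gt_1 by simp
  qed
qed

end

section \<open>Counting normal elements with primitive image\<close>

lemma add_char_sum:
  assumes "add_char \<psi>" "finite A"
  shows "\<psi> (\<Sum>i\<in>A. f i) = (\<Prod>i\<in>A. \<psi> (f i))"
  using assms(2) by (induction A rule: finite_induct) (auto simp: add_char_0[OF assms(1)] add_char_add[OF assms(1)])

text \<open>For the sieve terms without multiplicative part: the complete sum vanishes and only the
  kernel of \<open>L\<close> remains.\<close>

lemma trivial_char_sum_bound:
  fixes \<psi> :: "'a::{field,finite} \<Rightarrow> complex"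
  assumes \<psi>: "add_char \<psi>" "\<psi> z \<noteq> 1" and b: "b \<noteq> 0"
  shows "norm (\<Sum>x\<in>UNIV. (if L x = 0 then 0 else 1) * \<psi> (b * x)) \<le> card {x. L x = 0}"
proof -
  have "(\<Sum>x\<in>UNIV. (if L x = 0 then 0 else 1) * \<psi> (b * x))
      = (\<Sum>x\<in>UNIV. \<psi> (b * x)) - (\<Sum>x\<in>UNIV. if L x = 0 then \<psi> (b * x) else 0)"
    unfolding sum_subtractf[symmetric] by (intro sum.cong refl) simp
  also have "(\<Sum>x\<in>UNIV. \<psi> (b * x)) = 0"
    using sum_add_char_UNIV[OF \<psi>, of b] b by (simp add: mult.commute)
  also have "(\<Sum>x\<in>UNIV. if L x = 0 then \<psi> (b * x) else 0) = (\<Sum>x\<in>{x. L x = 0}. \<psi> (b * x))"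
    by (simp add: sum.If_cases)
  also have "norm (0 - (\<Sum>x\<in>{x. L x = 0}. \<psi> (b * x))) \<le> (\<Sum>x\<in>{x. L x = 0}. norm (\<psi> (b * x)))"
    by (simp add: norm_sum)
  also have "\<dots> = card {x. L x = 0}"
    by (simp add: add_char_norm[OF \<psi>(1)])
  finally show ?thesis .
qed

text \<open>Here \<open>s\<close> is the sum of \<open>m - 1\<close> nontrivial characters; it
  serves both \<open>m = p\<close> and \<open>m = q ^ degree P\<close>.\<close>

lemma sieve_factor:
  assumes m: "m > 1" and s: "s = (if Q then of_nat m else 0) - 1"
  shows "of_real (1 - 1 / real m) * (1 - s / of_nat (m - 1)) = (if Q then 0 else (1::complex))"
proof -
  have "of_nat (m - 1) = (of_nat m - 1 :: complex)"
    using m by (simp add: of_nat_diff)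
  moreover have "of_nat m - 1 \<noteq> (0::complex)" "of_nat m \<noteq> (0::complex)"
    using m by auto
  ultimately show ?thesis
    unfolding s by (auto simp: divide_simps)
qed

lemma prod_indicator:
  assumes "finite A"
  shows "(\<Prod>i\<in>A. if Q i then 0 else 1) = (if \<forall>i\<in>A. \<not> Q i then 1 else (0::complex))"
  using assms by (auto intro!: prod.neutral)

lemma theta_nat_eq_prod: "m > 0 \<Longrightarrow> theta_nat m = (\<Prod>p\<in>prime_factors m. 1 - 1 / real p)"
  by (simp add: theta_nat_def totient_formula2)

lemma not_primitive_elt_0: "\<not> primitive_elt (0::'a::field)"
proof
  assume "primitive_elt (0::'a)"
  then have "(0::'a) ^ 1 \<in> UNIV - {0}"
    unfolding primitive_elt_def by blast
  then show False by simp
qed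

context field_extension
begin

text \<open>The elements for which the factor \<open>P\<close> obstructs normality.\<close>

definition sub_kernel :: "'a poly \<Rightarrow> 'b set" where
  "sub_kernel P = {x. act (xn1 div P) x = 0}"

lemma add_subgroup_sub_kernel: "add_subgroup (sub_kernel P)"
  unfolding sub_kernel_def by (rule add_subgroup_kernel[OF additive_map_act])

lemma act_mem_sub_kernel:
  assumes P: "P dvd xn1" "P dvd g"
  shows "act g x \<in> sub_kernel P"
proof -
  obtain h where h: "g = P * h" using P by auto
  have "(xn1 div P) * g = h * xn1"
    using P(1) by (simp add: h mult_ac flip: mult.assoc)
  then have "act (xn1 div P) (act g x) = 0"
    using additive_map_0[OF additive_map_act, of h]
    by (simp only: act_mult[symmetric]) (simp only: act_mult act_xn1)
  then show ?thesis by (simp add: sub_kernel_def)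
qed

lemma card_perp_sub_kernel:
  assumes \<psi>: "add_char \<psi>" "\<psi> z \<noteq> 1" and P: "P dvd xn1"
  shows "card (perp \<psi> (sub_kernel P)) = q ^ degree P"
proof -
  have PT: "xn1 div P * P = xn1" using P by simp
  then have nz: "xn1 div P \<noteq> 0" "P \<noteq> 0"
    using xn1_nonzero by fastforce+
  have deg: "degree (xn1 div P) + degree P = n"
    using degree_mult_eq[OF nz] degree_xn1 PT by simp
  have "xn1 div P dvd xn1"
    using PT by (metis dvd_triv_left)
  then have "q ^ degree (xn1 div P) * card (perp \<psi> (sub_kernel P)) = q ^ (degree (xn1 div P) + degree P)"
    using card_mult_card_perp[OF \<psi> add_subgroup_sub_kernel, of P] card_kernel_act[of "xn1 div P"]
    unfolding deg by (simp add: sub_kernel_def card_ext)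
  then show ?thesis
    using q_gt_1 by (simp add: power_add)
qed

text \<open>By Bezout, every \<open>x\<close> is a sum of an element of \<open>sub_kernel P0\<close>
  and an element of all the other \<open>sub_kernel P\<close>. If the sum vanished, the character of
  \<open>b P0\<close> would be trivial on both parts. Hence the additive character of a sieve term
  with nonempty \<open>R\<close> is nontrivial.\<close>

lemma sum_perp_nonzero:
  assumes \<psi>: "add_char \<psi>" "\<psi> z \<noteq> 1"
    and R: "R \<subseteq> monic_irreducible_factors xn1" "R \<noteq> {}"
    and b: "\<And>P. P \<in> R \<Longrightarrow> b P \<in> perp \<psi> (sub_kernel P) - {0}"
  shows "(\<Sum>P\<in>R. b P) \<noteq> 0"
proof
  assume sum0: "(\<Sum>P\<in>R. b P) = 0"
  obtain P0 where P0: "P0 \<in> R" using R by auto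
  have fin: "finite R"
    using R finite_monic_irreducible_factors[OF xn1_nonzero] finite_subset by blast
  have RT: "lead_coeff P = 1" "irreducible P" "P dvd xn1" if "P \<in> R" for P
    using R that by (auto simp: monic_irreducible_factors_def)
  let ?Q = "\<Prod>(R - {P0})"
  have "\<exists>u v. u * P0 + v * ?Q = 1"
  proof (rule bezout_poly)
    show "P0 \<noteq> 0 \<or> ?Q \<noteq> 0"
      using RT(1)[OF P0] by auto
    fix P assume P: "lead_coeff P = 1" "irreducible P" "P dvd P0" "P dvd ?Q"
    then have "P = P0"
      using monic_irreducible_dvd_imp_eq RT P0 by blast
    then show False
      using irreducible_dvd_prod_monic_iff[of "R - {P0}" P] P RT fin by auto
  qed
  then obtain u v where uv: "u * P0 + v * ?Q = 1" by blast
  have "\<psi> (b P0 * x) = 1" for x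
  proof -
    let ?y = "act (v * ?Q) x"
    have x: "x = act (u * P0) x + ?y"
      unfolding act_add[symmetric] uv by (simp add: act_1)
    have "act (u * P0) x \<in> sub_kernel P0"
      by (rule act_mem_sub_kernel[OF RT(3)[OF P0]]) simp
    then have 1: "\<psi> (b P0 * act (u * P0) x) = 1"
      using b[OF P0] by (simp add: perp_def)
    have other: "\<psi> (b P * ?y) = 1" if P: "P \<in> R - {P0}" for P
    proof -
      have "P dvd ?Q"
        using fin P dvd_prodI[of "R - {P0}" P "\<lambda>P. P"] by auto
      then have "?y \<in> sub_kernel P"
        using P by (intro act_mem_sub_kernel RT(3)) auto
      then show ?thesis
        using b[of P] P by (simp add: perp_def)
    qed
    \<comment> \<open>At \<open>?y\<close> all factors except the one at \<open>P0\<close> are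
      \<open>1\<close>, which isolates it.\<close>
    have "1 = \<psi> ((\<Sum>P\<in>R. b P) * ?y)"
      by (simp add: sum0 add_char_0[OF \<psi>(1)])
    also have "\<dots> = \<psi> (b P0 * ?y) * (\<Prod>P\<in>R - {P0}. \<psi> (b P * ?y))"
      unfolding sum_distrib_right add_char_sum[OF \<psi>(1) fin] by (rule prod.remove[OF fin P0])
    also have "(\<Prod>P\<in>R - {P0}. \<psi> (b P * ?y)) = 1"
      using other by (intro prod.neutral) blast
    finally have 2: "\<psi> (b P0 * ?y) = 1" by simp
    have "\<psi> (b P0 * x) = \<psi> (b P0 * act (u * P0) x) * \<psi> (b P0 * ?y)"
      by (subst x) (simp only: distrib_left add_char_add[OF \<psi>(1)])
    then show ?thesis by (simp only: 1 2 mult_1)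
  qed
  \<comment> \<open>At this point the character of \<open>b P0\<close> takes the value
    \<open>\<psi> z \<noteq> 1\<close>.\<close>
  from this[of "z / b P0"] show False
    using b[OF P0] \<psi>(2) by simp
qed

text \<open>Both kinds of obstruction are indexed by one disjoint sum, so a single sieve treats them
  together. The subtracted \<open>real q ^ degree f\<close> counts the kernel of
  \<open>act f\<close>, where the weight \<open>h\<close> vanishes.\<close>

lemma normal_primitive_count:
  assumes f: "f dvd xn1"
  defines "A \<equiv> {x. normal_elt emb q n x \<and> primitive_elt (act f x)}"
    and "I \<equiv> Sum_Type.Plus (prime_factors (q ^ n - 1)) (monic_irreducible_factors xn1)"
  shows "\<bar>real (card A) / (theta_nat (q ^ n - 1) * Theta_poly q xn1) - (real q ^ n - real q ^ degree f)\<bar>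
    \<le> (2 ^ card I - 1) * (real q ^ degree f * sqrt (real q ^ n))"
proof -
  let ?M = "q ^ n - 1" and ?F = "monic_irreducible_factors xn1" and ?L = "act f"
  obtain g :: 'b where gen: "range (\<lambda>i::nat. g ^ i) = UNIV - {0}"
    using finite_field_generator by metis
  interpret G: primitive_root g ?M
    using gen by unfold_locales (simp_all add: card_ext)
  obtain \<psi> :: "'b \<Rightarrow> complex" where \<psi>: "add_char \<psi>" "\<psi> 1 \<noteq> 1"
    using exists_nontrivial_add_char by blast
  have finF: "finite ?F"
    by (rule finite_monic_irreducible_factors[OF xn1_nonzero])
  have finI: "finite I"
    unfolding I_def using finF by (intro finite_Plus) auto
  have M0: "?M > 0" by (rule G.M_pos)
  have kerL: "card {x. ?L x = 0} = q ^ degree f"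
    by (rule card_kernel_act[OF f])
  have factor: "P dvd xn1" "irreducible P" if "P \<in> ?F" for P
    using that by (auto simp: monic_irreducible_factors_def)
  have qP: "q ^ degree P > 1" if "P \<in> ?F" for P
    using q_gt_1 irreducible_poly_degree_pos[OF factor(2)[OF that]] by (rule one_less_power)
  define D where "D P = perp \<psi> (sub_kernel P) - {0}" for P
  have cardD: "card (D P) = q ^ degree P - 1" if "P \<in> ?F" for P
    unfolding D_def using card_perp_sub_kernel[OF \<psi> factor(1)[OF that]]
      add_subgroup_zero[OF add_subgroup_perp[OF \<psi>(1)]] by simp
  \<comment> \<open>Where \<open>?L x = 0\<close> the value of \<open>c1\<close> is arbitrary; the
    weight \<open>h\<close> removes these points.\<close>
  define c1 where "c1 p t x = unity_root p (t * G.ind (?L x))" for p t x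
  define c2 where "c2 b x = \<psi> (b * x)" for b x
  define C where "C = case_sum (\<lambda>p. c1 p ` {1..<p}) (\<lambda>P. c2 ` D P)"
  define u where "u = case_sum (\<lambda>p x. (\<Sum>t\<in>{1..<p}. c1 p t x) / of_nat (card {1..<p}))
    (\<lambda>P x. (\<Sum>b\<in>D P. c2 b x) / of_nat (card (D P)))"
  define h :: "'b \<Rightarrow> complex" where "h x = (if ?L x = 0 then 0 else 1)" for x
  have avg: "averages (u i) (C i)" if i: "i \<in> I" for i
  proof -
    consider p where "i = Inl p" "prime p" | P where "i = Inr P" "P \<in> ?F"
      using i unfolding I_def by (auto simp: in_prime_factors_iff)
    then show ?thesis
    proof cases
      case 1
      then have "{1..<p} \<noteq> {}" using prime_gt_1_nat[of p] by simp
      then show ?thesis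
        unfolding u_def C_def 1 sum.case by (intro averages_mean) auto
    next
      case 2
      then have "D P \<noteq> {}" using cardD[of P] qP[of P] by force
      then show ?thesis
        unfolding u_def C_def 2 sum.case by (intro averages_mean) auto
    qed
  qed
  have bound: "norm (\<Sum>x\<in>UNIV. (\<Prod>i\<in>J. e i x) * h x) \<le> real q ^ degree f * sqrt (real q ^ n)"
    if J: "J \<subseteq> I" "J \<noteq> {}" and e: "\<And>i. i \<in> J \<Longrightarrow> e i \<in> C i" for J e
  proof -
    \<comment> \<open>Splitting \<open>J\<close> into its multiplicative part \<open>S\<close> and
      additive part \<open>R\<close> collapses each product to one pair of characters.\<close>
    define S where "S = {p. Inl p \<in> J}"
    define R where "R = {P. Inr P \<in> J}"
    have JSR: "J = Sum_Type.Plus S R"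
    proof (rule Set.set_eqI)
      fix i
      show "i \<in> J \<longleftrightarrow> i \<in> Sum_Type.Plus S R"
        by (cases i) (auto simp: S_def R_def)
    qed
    have S: "S \<subseteq> prime_factors ?M" and R: "R \<subseteq> ?F"
      using J(1) unfolding S_def R_def I_def by auto
    have fin: "finite S" "finite R"
      using S R finF finite_subset by blast+
    have "e (Inl p) \<in> c1 p ` {1..<p}" if "p \<in> S" for p
      using e[of "Inl p"] that by (simp add: S_def C_def)
    then have "\<exists>t. \<forall>p\<in>S. e (Inl p) = c1 p (t p) \<and> t p \<in> {1..<p}"
      by (intro bchoice) blast
    then obtain t where t: "\<And>p. p \<in> S \<Longrightarrow> e (Inl p) = c1 p (t p) \<and> t p \<in> {1..<p}" by blast
    have "e (Inr P) \<in> c2 ` D P" if "P \<in> R" for P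
      using e[of "Inr P"] that by (simp add: R_def C_def)
    then have "\<exists>b. \<forall>P\<in>R. e (Inr P) = c2 (b P) \<and> b P \<in> D P"
      by (intro bchoice) blast
    then obtain b where b: "\<And>P. P \<in> R \<Longrightarrow> e (Inr P) = c2 (b P) \<and> b P \<in> D P" by blast
    let ?b = "\<Sum>P\<in>R. b P"
    have "(\<Prod>i\<in>J. e i x) * h x = G.prod_char S t (?L x) * \<psi> (?b * x)" for x
    proof -
      have "(\<Prod>i\<in>J. e i x) = (\<Prod>p\<in>S. e (Inl p) x) * (\<Prod>P\<in>R. e (Inr P) x)"
        unfolding JSR using fin by (simp add: prod.Plus)
      also have "(\<Prod>p\<in>S. e (Inl p) x) = (\<Prod>p\<in>S. unity_root p (t p * G.ind (?L x)))"
        using t by (intro prod.cong refl) (simp add: c1_def)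
      also have "(\<Prod>P\<in>R. e (Inr P) x) = (\<Prod>P\<in>R. \<psi> (b P * x))"
        using b by (intro prod.cong refl) (simp add: c2_def)
      also have "\<dots> = \<psi> (?b * x)"
        by (simp add: sum_distrib_right add_char_sum[OF \<psi>(1) fin(2)])
      finally show ?thesis
        by (simp add: h_def G.prod_char_def)
    qed
    then have eq: "(\<Sum>x\<in>UNIV. (\<Prod>i\<in>J. e i x) * h x) = (\<Sum>x\<in>UNIV. G.prod_char S t (?L x) * \<psi> (?b * x))"
      by simp
    show ?thesis
    \<comment> \<open>If \<open>S\<close> is nonempty the multiplicative character is nontrivial and
      any \<open>?b\<close> is admissible; otherwise \<open>R\<close> is nonempty and
      \<open>?b \<noteq> 0\<close>.\<close>
    proof (cases "S = {}")
      case False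
      have "0 < t p \<and> t p < p" if "p \<in> S" for p
        using t[OF that] by simp
      then obtain w where w: "w \<noteq> 0" "G.prod_char S t w \<noteq> 1"
        using G.prod_char_nontrivial[OF S False] by blast
      show ?thesis
        unfolding eq using twisted_char_sum_bound[OF G.mult_char_prod_char[OF S] w \<psi> additive_map_act[of f], of ?b]
        by (simp add: kerL card_ext)
    next
      case True
      then have "R \<noteq> {}" using J(2) JSR by auto
      then have "?b \<noteq> 0"
        using sum_perp_nonzero[OF \<psi> R] b unfolding D_def by blast
      from trivial_char_sum_bound[OF \<psi> this, of ?L]
      have "norm (\<Sum>x\<in>UNIV. G.prod_char S t (?L x) * \<psi> (?b * x)) \<le> real q ^ degree f"
        by (simp add: True G.prod_char_def kerL cong: if_cong)
      also have "\<dots> \<le> real q ^ degree f * sqrt (real q ^ n)"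
        using q_gt_1 by (simp add: one_le_power)
      finally show ?thesis unfolding eq .
    qed
  qed
  have sieve: "norm ((\<Sum>x\<in>UNIV. (\<Prod>i\<in>I. 1 - u i x) * h x) - (\<Sum>x\<in>UNIV. h x))
      \<le> (2 ^ card I - 1) * (real q ^ degree f * sqrt (real q ^ n))"
    by (rule character_sieve[OF finI avg bound]) auto
  have sumh: "(\<Sum>x\<in>UNIV. h x) = of_real (real q ^ n - real q ^ degree f)"
  proof -
    have "(\<Sum>x\<in>UNIV. h x) = (\<Sum>x\<in>UNIV. 1 - (if ?L x = 0 then 1 else 0))"
      by (intro sum.cong refl) (simp add: h_def)
    also have "\<dots> = of_real (real q ^ n - real q ^ degree f)"
      by (simp add: sum_subtractf sum.If_cases kerL card_ext)
    finally show ?thesis .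
  qed
  let ?th = "theta_nat ?M" and ?Th = "Theta_poly q xn1"
  have th: "?th = (\<Prod>p\<in>prime_factors ?M. 1 - 1 / real p)"
    by (rule theta_nat_eq_prod[OF M0])
  have Th: "?Th = (\<Prod>P\<in>?F. 1 - 1 / real q ^ degree P)"
    by (rule Theta_poly_eq_prod[OF _ q]) (use degree_xn1 n in simp)
  have th0: "?th > 0"
    unfolding th
  proof (rule prod_pos)
    fix p assume "p \<in> prime_factors ?M"
    then have "p > 1" using prime_gt_1_nat by (auto simp: in_prime_factors_iff)
    then show "0 < 1 - 1 / real p" by simp
  qed
  have Th0: "?Th > 0"
    unfolding Th
  proof (rule prod_pos)
    fix P assume "P \<in> ?F"
    then have "real (q ^ degree P) > 1" using qP by (metis of_nat_1 of_nat_less_iff)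
    then show "0 < 1 - 1 / real q ^ degree P" by (auto simp: divide_less_eq)
  qed
  have ind1: "of_real (1 - 1 / real p) * (1 - u (Inl p) x) = (if p dvd G.ind (?L x) then 0 else 1)"
    if "p \<in> prime_factors ?M" for p x
  proof -
    have p: "prime p" using that by (auto simp: in_prime_factors_iff)
    show ?thesis
      using sieve_factor[OF prime_gt_1_nat[OF p] mean_unity_roots[OF p, of "G.ind (?L x)"]]
      by (simp add: u_def c1_def)
  qed
  have ind2: "of_real (1 - 1 / real q ^ degree P) * (1 - u (Inr P) x) = (if x \<in> sub_kernel P then 0 else 1)"
    if P: "P \<in> ?F" for P x
  proof -
    have zero: "0 \<in> perp \<psi> (sub_kernel P)"
      by (rule add_subgroup_zero[OF add_subgroup_perp[OF \<psi>(1)]])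
    \<comment> \<open>Splitting off \<open>b = 0\<close> produces the \<open>- 1\<close> that
      \<open>sieve_factor\<close> expects.\<close>
    have "(\<Sum>b\<in>perp \<psi> (sub_kernel P). \<psi> (b * x)) = \<psi> (0 * x) + (\<Sum>b\<in>D P. \<psi> (b * x))"
      unfolding D_def by (rule sum.remove[OF _ zero]) simp
    then have "(\<Sum>b\<in>D P. c2 b x) = (if x \<in> sub_kernel P then of_nat (q ^ degree P) else 0) - 1"
      unfolding c2_def sum_perp_add_char[OF \<psi> add_subgroup_sub_kernel] card_perp_sub_kernel[OF \<psi> factor(1)[OF P]]
      by (simp add: add_char_0[OF \<psi>(1)] algebra_simps)
    from sieve_factor[OF qP[OF P] this] show ?thesis
      by (simp add: u_def cardD[OF P])
  qed
  \<comment> \<open>Distributing the factors of \<open>?th * ?Th\<close> over \<open>I\<close> turns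
    each \<open>1 - u i x\<close> into a 0-1 indicator.\<close>
  have "of_real (?th * ?Th) * ((\<Prod>i\<in>I. 1 - u i x) * h x) = (if x \<in> A then 1 else 0)" for x
  proof -
    have "of_real (?th * ?Th) * (\<Prod>i\<in>I. 1 - u i x)
        = (\<Prod>p\<in>prime_factors ?M. of_real (1 - 1 / real p) * (1 - u (Inl p) x))
        * (\<Prod>P\<in>?F. of_real (1 - 1 / real q ^ degree P) * (1 - u (Inr P) x))"
      unfolding th Th I_def using finF by (simp add: prod.Plus prod.distrib mult_ac)
    also have "\<dots> = (\<Prod>p\<in>prime_factors ?M. if p dvd G.ind (?L x) then 0 else 1)
        * (\<Prod>P\<in>?F. if x \<in> sub_kernel P then 0 else 1)"
      by (intro arg_cong2[of _ _ _ _ "(*)"] prod.cong refl ind1 ind2)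
    also have "\<dots> = (if (\<forall>p\<in>prime_factors ?M. \<not> p dvd G.ind (?L x)) \<and> (\<forall>P\<in>?F. x \<notin> sub_kernel P) then 1 else 0)"
      using finF by (simp add: prod_indicator)
    finally have *: "of_real (?th * ?Th) * (\<Prod>i\<in>I. 1 - u i x) = \<dots>" .
    have normal: "normal_elt emb q n x \<longleftrightarrow> (\<forall>P\<in>?F. x \<notin> sub_kernel P)"
      by (simp add: normal_elt_iff sub_kernel_def)
    show ?thesis
    proof (cases "?L x = 0")
      case True
      then show ?thesis
        by (simp add: h_def A_def not_primitive_elt_0)
    next
      case False
      then show ?thesis
        unfolding mult.assoc[symmetric] * A_def
        by (simp add: h_def normal G.primitive_elt_iff[OF False] conj_commute)
    qed
  qed
  then have "of_real (?th * ?Th) * (\<Sum>x\<in>UNIV. (\<Prod>i\<in>I. 1 - u i x) * h x) = (\<Sum>x\<in>UNIV. if x \<in> A then 1 else 0)"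
    by (simp only: sum_distrib_left)
  also have "\<dots> = of_real (real (card A))"
    by (simp add: sum.If_cases)
  finally have "(\<Sum>x\<in>UNIV. (\<Prod>i\<in>I. 1 - u i x) * h x) = of_real (real (card A) / (?th * ?Th))"
    using th0 Th0 by (simp add: field_simps)
  then show ?thesis
    using sieve unfolding sumh by (simp only: norm_of_real flip: of_real_diff)
qed

end

section \<open>The lower bound and the existence of primitive k-normal elements\<close>

theorem theorem3p3:
  fixes emb :: "'a::{field,finite} \<Rightarrow> 'b::{field,finite}"
    and q n k :: nat and f :: "'a poly"
  assumes "q = card (UNIV::'a set)"
    and "n > 0"
    and "card (UNIV::'b set) = q ^ n"
    and "ring_emb emb"
    and "f dvd (monom 1 n - 1)"
    and "degree f = k"
  shows "real (card {\<alpha>::'b. normal_elt emb q n \<alpha> \<and> primitive_elt (q_assoc emb q f \<alpha>)})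
           / (theta_nat (q ^ n - 1) * Theta_poly q (monom (1::'a) n - 1))
         > real q ^ n - real q powr (real n / 2 + real k)
             * real (W_nat (q ^ n - 1)) * real (W_poly (monom (1::'a) n - 1))
       \<and> (real q powr (real n / 2 - real k)
             \<ge> real (W_nat (q ^ n - 1)) * real (W_poly (monom (1::'a) n - 1))
          \<longrightarrow> (\<exists>\<alpha>::'b. primitive_elt \<alpha> \<and> k_normal emb q n k \<alpha>))"
proof -
  interpret field_extension emb q n
    using assms(1-4) by unfold_locales
  let ?A = "{\<alpha>::'b. normal_elt emb q n \<alpha> \<and> primitive_elt (q_assoc emb q f \<alpha>)}"
  let ?Z = "real (card ?A) / (theta_nat (q ^ n - 1) * Theta_poly q xn1)"
  let ?I = "Sum_Type.Plus (prime_factors (q ^ n - 1)) (monic_irreducible_factors xn1)"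
  let ?W = "real (W_nat (q ^ n - 1)) * real (W_poly xn1)"
  let ?B = "real q ^ k * sqrt (real q ^ n)"
  have q1: "real q > 1" using q_gt_1 by simp
  have "q ^ n > 1" using q_gt_1 n by (rule one_less_power)
  then have M0: "q ^ n - 1 > 0" and qn1: "real q ^ n > 1"
    by (simp, metis of_nat_1 of_nat_less_iff of_nat_power)
  have B: "?B = real q powr (real n / 2 + real k)"
  proof -
    have "sqrt (real q ^ n) = real q powr (real n / 2)"
      using q1 by (simp add: powr_half_sqrt[symmetric] powr_powr flip: powr_realpow)
    then show ?thesis
      using q1 by (simp add: powr_add powr_realpow mult.commute)
  qed
  have finF: "finite (monic_irreducible_factors xn1)"
    by (rule finite_monic_irreducible_factors[OF xn1_nonzero])
  have "2 ^ card ?I \<le> W_nat (q ^ n - 1) * W_poly xn1"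
    using mult_mono[OF W_nat_ge[OF M0] W_poly_ge[OF xn1_nonzero]] finF by (simp add: card_Plus power_add)
  then have W: "2 ^ card ?I \<le> ?W"
    by (metis of_nat_le_iff of_nat_mult of_nat_numeral of_nat_power)
  have "\<bar>?Z - (real q ^ n - real q ^ k)\<bar> \<le> (2 ^ card ?I - 1) * ?B"
    using normal_primitive_count[OF assms(5)] unfolding assms(6) .
  then have "?Z \<ge> real q ^ n - real q ^ k - (2 ^ card ?I - 1) * ?B"
    by linarith
  \<comment> \<open>Source of the strict inequality: the \<open>- 1\<close> in
    \<open>2 ^ card ?I - 1\<close> spares one \<open>?B\<close>, which more than absorbs
    \<open>real q ^ k\<close>.\<close>
  moreover have "real q ^ k < ?B"
    using q1 qn1 by simp
  ultimately have "?Z > real q ^ n - 2 ^ card ?I * ?B"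
    by (simp add: left_diff_distrib)
  moreover have "2 ^ card ?I * ?B \<le> ?W * ?B"
    using W by (intro mult_right_mono) auto
  ultimately have main: "?Z > real q ^ n - real q powr (real n / 2 + real k) * real (W_nat (q ^ n - 1)) * real (W_poly xn1)"
    unfolding B by (simp add: mult_ac)
  have "\<exists>\<alpha>::'b. primitive_elt \<alpha> \<and> k_normal emb q n k \<alpha>"
    if le: "?W \<le> real q powr (real n / 2 - real k)"
  proof -
    \<comment> \<open>The hypothesis bounds the error term by \<open>real q ^ n\<close>; as the main
      inequality is strict, \<open>?Z\<close> is positive even in the case of equality.\<close>
    have "real q powr (real n / 2 + real k) * ?W
        \<le> real q powr (real n / 2 + real k) * real q powr (real n / 2 - real k)"
      using le by (intro mult_left_mono) auto
    also have "\<dots> = real q ^ n"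
      using q1 by (simp add: powr_realpow flip: powr_add)
    finally have "?Z > 0"
      using main by (simp add: mult.assoc)
    then have "?A \<noteq> {}"
      by (intro notI) (simp only: card.empty of_nat_0 div_0 less_irrefl)
    then obtain \<alpha> where "\<alpha> \<in> ?A"
      by blast
    then show ?thesis
      using k_normal_act[OF assms(5)] assms(6) by blast
  qed
  with main show ?thesis
    by blast
qed

end
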